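(* Let $d=3$, $\kappa\in\mathbb R^4$ with all $\kappa_i>-1$, and $\nu,\mu\in\mathbb N_0^3$ with $|\nu|=|\mu|=n$. Put $\widehat\kappa=(\kappa_1,\kappa_2,\widehat\kappa_3)$ with $\widehat\kappa_3=\kappa_3+\kappa_4+2\nu_3+1$. Then $$c_{\nu,\mu}^{(12)}(\kappa)=\delta_{\nu_3,\mu_3}\,c_{\nu_2,\mu_2}^{(12)}(\widehat\kappa,n-\nu_3)$$ $$=\delta_{\nu_3,\mu_3}\,D_{\nu_2,\mu_2}^{n-\nu_3}(\kappa_1,\kappa_2,\widehat\kappa_3)\;{}_4F_3\!\left(\begin{matrix}-\mu_2,\ \mu_2+\kappa_2+\widehat\kappa_3+1,\ -\nu_2,\ \nu_2+\kappa_1+\widehat\kappa_3+1\\-n+\nu_3,\ \widehat\kappa_3+1,\ n+\nu_3+|\kappa|+3\end{matrix};1\right),$$ where $c_{j,m}^{(12)}(\cdot,\cdot)$ on the right of the first line are the connection coefficients in two variables. Furthermore, $$c_{\nu,\mu}^{(34)}(\kappa)=(-1)^{\nu_3}\delta_{\nu,\mu},\qquad c_{\nu,\mu}^{(12)(34)}(\kappa)=(-1)^{\nu_3}c_{\nu,\mu}^{(12)}(\kappa).$$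
   Context: **Vectors.** $|y|$ is the sum of the entries of $y$; $\mathbf y_j=(y_1,\dots,y_j)$; $\mathbf y^j$ is the tail from the $j$-th to the last entry ($\boldsymbol\kappa^j=(\kappa_j,\dots,\kappa_{d+1})$, $\boldsymbol\nu^j=(\nu_j,\dots,\nu_d)$); empty parts have sum $0$. $(a)_k=a(a+1)\cdots(a+k-1)$. **Jacobi polynomials on the simplex** in $d$ variables, for $\kappa\in\mathbb R^{d+1}$, $\kappa_i>-1$, $\nu\in\mathbb N_0^d$: with $a_j=|\boldsymbol\kappa^{j+1}|+2|\boldsymbol\nu^{j+1}|+d-j$, $$P_\nu^\kappa(x)=\prod_{j=1}^d(1-|\mathbf x_{j-1}|)^{\nu_j}P_{\nu_j}^{(a_j,\kappa_j)}\Big(\frac{2x_j}{1-|\mathbf x_{j-1}|}-1\Big)$$ (classical Jacobi polynomials, $P_n^{(\alpha,\beta)}(1)=(\alpha+1)_n/n!$). For each $n$, $\{P_\nu^\kappa:|\nu|=n\}$ is an orthogonal basis of the space of degree-$n$ orthogonal polynomials on $T^d=\{x\in\mathbb R^d:x_i\ge0,|x|\le1\}$ for the weight $x_1^{\kappa_1}\cdots x_d^{\kappa_d}(1-|x|)^{\kappa_{d+1}}$. **Connection coefficients.** For $\tau\in S_{d+1}$: $\tau y=(y_{\tau(1)},\dots,y_{\tau(d+1)})$ for $y\in\mathbb R^{d+1}$, and $\tau x=(x_{\tau(1)},\dots,x_{\tau(d)})$ with $x_{d+1}:=1-|x|$. $c^\tau_{\nu,\mu}(\kappa)$ is defined by $P_\nu^{\tau\kappa}(\tau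 x)=\sum_{|\mu|=n}c^\tau_{\nu,\mu}(\kappa)P_\mu^\kappa(x)$, $|\nu|=n$. For $d=2$, write $c^\tau_{j,m}(\kappa,n):=c^\tau_{(n-j,j),(n-m,m)}(\kappa)$, $0\le j,m\le n$, i.e. $P^{\tau\kappa}_{n-j,j}(x_{\tau(1)},x_{\tau(2)})=\sum_{m=0}^nc_{j,m}^\tau(\kappa,n)P_{n-m,m}^\kappa(x_1,x_2)$ with $x_3=1-x_1-x_2$. **The constant $D$.** For $\kappa=(\kappa_1,\kappa_2,\kappa_3)$ and $0\le j,m\le n$, $$D_{j,m}^n(\kappa)=(-1)^{n+m}\frac{(-n)_j(\kappa_2+1)_{n-j}(\kappa_3+1)_j}{j!\,(\kappa_2+1)_m}\cdot\frac{(n+|\kappa|+2)_m}{(\kappa_2+\kappa_3+2m+2)_{n-m}(\kappa_2+\kappa_3+m+1)_m}.$$ The ${}_4F_3$ is a terminating sum over $0\le k\le\min(\mu_2,\nu_2)$. *)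

theory Defs
  imports
    "HOL-Computational_Algebra.Computational_Algebra"
    "HOL-Combinatorics.Transposition"
begin

text \<open>
  Vectors are functions on \<^typ>\<open>nat\<close> of which only the entries with index in \<open>{1..d}\<close>
  (or \<open>{1..d+1}\<close> for parameter vectors) are used.
\<close>

text \<open>
  The classical Jacobi polynomial in the form
  \<open>P\<^sub>n(x) = \<Sum>l\<le>n. (n+\<alpha>+\<beta>+1)\<^sub>l (\<alpha>+l+1)\<^sub>n\<^sub>-\<^sub>l / (l! (n-l)!) ((x-1)/2)\<^sup>l\<close>,
  which for \<open>\<alpha> > -1\<close> is the usual \<open>(\<alpha>+1)\<^sub>n/n! 2F1(-n, n+\<alpha>+\<beta>+1; \<alpha>+1; (1-x)/2)\<close>
  with the denominators \<open>(\<alpha>+1)\<^sub>l\<close> cancelled.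
\<close>

definition jacobi :: "nat \<Rightarrow> real \<Rightarrow> real \<Rightarrow> real poly" where
  "jacobi n \<alpha> \<beta> = (\<Sum>l\<le>n.
     smult (pochhammer (real n + \<alpha> + \<beta> + 1) l * pochhammer (\<alpha> + real l + 1) (n - l)
              / (fact l * fact (n - l)))
       ([:-1/2, 1/2:] ^ l))"

lemma degree_jacobi_le: "degree (jacobi n \<alpha> \<beta>) \<le> n"
  unfolding jacobi_def
proof (rule degree_sum_le)
  fix l assume "l \<in> {..n}"
  have "degree ([:-1/2, 1/2 :: real:] ^ l) \<le> degree [:-1/2, 1/2 :: real:] * l"
    by (rule degree_power_le)
  also have "\<dots> \<le> n" using \<open>l \<in> {..n}\<close> by simp
  finally show "degree (smult (pochhammer (real n + \<alpha> + \<beta> + 1) l *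
      pochhammer (\<alpha> + real l + 1) (n - l) / (fact l * fact (n - l))) ([:-1/2, 1/2:] ^ l)) \<le> n"
    using degree_smult_le le_trans by blast
qed simp

lemma poly_jacobi_1: "poly (jacobi n \<alpha> \<beta>) 1 = pochhammer (\<alpha> + 1) n / fact n"
proof -
  have "poly (jacobi n \<alpha> \<beta>) 1 = (\<Sum>l\<le>n.
      pochhammer (real n + \<alpha> + \<beta> + 1) l * pochhammer (\<alpha> + real l + 1) (n - l)
        / (fact l * fact (n - l)) * 0 ^ l)"
    unfolding jacobi_def poly_sum by (intro sum.cong refl) simp
  also have "\<dots> = (\<Sum>l\<in>{0}. 
      pochhammer (real n + \<alpha> + \<beta> + 1) l * pochhammer (\<alpha> + real l + 1) (n - l)
        / (fact l * fact (n - l)) * 0 ^ l)"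
    by (intro sum.mono_neutral_right) auto
  finally show ?thesis by simp
qed

text \<open>
  \<open>homog n p s t\<close> is the polynomial \<open>s\<^sup>n p(t/s)\<close> in \<open>s\<close> and \<open>t\<close>, for \<open>degree p \<le> n\<close>.
  It is used because in HOL \<open>t / 0 = 0\<close>, so that the expression \<open>s ^ n * poly p (t / s)\<close>
  would not have the right value at \<open>s = 0\<close>.
\<close>

definition homog :: "nat \<Rightarrow> real poly \<Rightarrow> real \<Rightarrow> real \<Rightarrow> real" where
  "homog n p s t = (\<Sum>i\<le>n. coeff p i * t ^ i * s ^ (n - i))"

lemma homog_eq:
  assumes "degree p \<le> n" "s \<noteq> 0"
  shows "homog n p s t = s ^ n * poly p (t / s)"
proof -
  have "poly p (t / s) = (\<Sum>i\<le>n. coeff p i * (t / s) ^ i)"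
    unfolding poly_altdef
    by (intro sum.mono_neutral_left) (use assms in \<open>auto simp: coeff_eq_0\<close>)
  then have "s ^ n * poly p (t / s) = (\<Sum>i\<le>n. s ^ n * (coeff p i * (t / s) ^ i))"
    by (simp add: sum_distrib_left)
  also have "\<dots> = homog n p s t"
    unfolding homog_def
    by (intro sum.cong refl) (use assms in \<open>auto simp: power_divide power_diff\<close>)
  finally show ?thesis by simp
qed

definition jacobi_index :: "nat \<Rightarrow> (nat \<Rightarrow> real) \<Rightarrow> (nat \<Rightarrow> nat) \<Rightarrow> nat \<Rightarrow> real" where
  "jacobi_index d \<kappa> \<nu> j =
     (\<Sum>i=j+1..d+1. \<kappa> i) + 2 * real (\<Sum>i=j+1..d. \<nu> i) + real (d - j)"

definition simplex_jacobi ::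
    "nat \<Rightarrow> (nat \<Rightarrow> real) \<Rightarrow> (nat \<Rightarrow> nat) \<Rightarrow> (nat \<Rightarrow> real) \<Rightarrow> real" where
  "simplex_jacobi d \<kappa> \<nu> x =
     (\<Prod>j=1..d. homog (\<nu> j)
        (pcompose (jacobi (\<nu> j) (jacobi_index d \<kappa> \<nu> j) (\<kappa> j)) [:-1, 2:])
        (1 - (\<Sum>i=1..<j. x i)) (x j))"

lemma simplex_jacobi_eq:
  assumes "\<And>j. j \<in> {1..d} \<Longrightarrow> (\<Sum>i=1..<j. x i) \<noteq> 1"
  shows "simplex_jacobi d \<kappa> \<nu> x =
     (\<Prod>j=1..d. (1 - (\<Sum>i=1..<j. x i)) ^ \<nu> j *
        poly (jacobi (\<nu> j) (jacobi_index d \<kappa> \<nu> j) (\<kappa> j))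
          (2 * x j / (1 - (\<Sum>i=1..<j. x i)) - 1))"
  unfolding simplex_jacobi_def
proof (intro prod.cong refl)
  fix j assume j: "j \<in> {1..d}"
  let ?p = "jacobi (\<nu> j) (jacobi_index d \<kappa> \<nu> j) (\<kappa> j)"
  have "degree (pcompose ?p [:-1, 2:]) \<le> \<nu> j"
    using degree_pcompose_le[of ?p "[:-1, 2:]"] degree_jacobi_le[of "\<nu> j"]
    by (simp add: le_trans)
  then show "homog (\<nu> j) (pcompose ?p [:-1, 2:]) (1 - (\<Sum>i=1..<j. x i)) (x j) =
      (1 - (\<Sum>i=1..<j. x i)) ^ \<nu> j * poly ?p (2 * x j / (1 - (\<Sum>i=1..<j. x i)) - 1)"
    using assms[OF j] by (subst homog_eq) (auto simp: poly_pcompose mult.commute)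
qed

definition multi_indices :: "nat \<Rightarrow> nat \<Rightarrow> (nat \<Rightarrow> nat) set" where
  "multi_indices d n = {\<nu>. (\<forall>i. i \<notin> {1..d} \<longrightarrow> \<nu> i = 0) \<and> (\<Sum>i=1..d. \<nu> i) = n}"

text \<open>The barycentric extension \<open>(x\<^sub>1, \<dots>, x\<^sub>d, 1 - |x|)\<close>.\<close>

definition simplex_ext :: "nat \<Rightarrow> (nat \<Rightarrow> real) \<Rightarrow> nat \<Rightarrow> real" where
  "simplex_ext d x = x(d + 1 := 1 - (\<Sum>i=1..d. x i))"

text \<open>
  For a permutation \<open>\<tau>\<close> of \<open>{1..d+1}\<close>, the vector \<open>\<tau>y\<close> is \<open>y \<circ> \<tau>\<close>. The family of coefficients is
  set to zero outside the multi-indices of degree \<open>|\<nu>|\<close>, so that it is determined uniquely as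
  a function of \<open>\<mu>\<close>.
\<close>

definition conn_coeff ::
    "nat \<Rightarrow> (nat \<Rightarrow> nat) \<Rightarrow> (nat \<Rightarrow> real) \<Rightarrow> (nat \<Rightarrow> nat) \<Rightarrow> (nat \<Rightarrow> nat) \<Rightarrow> real" where
  "conn_coeff d \<tau> \<kappa> \<nu> =
     (THE c. (\<forall>\<mu>. \<mu> \<notin> multi_indices d (\<Sum>i=1..d. \<nu> i) \<longrightarrow> c \<mu> = 0) \<and>
       (\<forall>x. simplex_jacobi d (\<kappa> \<circ> \<tau>) \<nu> (simplex_ext d x \<circ> \<tau>) =
         (\<Sum>\<mu>\<in>multi_indices d (\<Sum>i=1..d. \<nu> i). c \<mu> * simplex_jacobi d \<kappa> \<mu> x)))"

definition pair_index :: "nat \<Rightarrow> nat \<Rightarrow> nat \<Rightarrow> nat" where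
  "pair_index a b = (\<lambda>_. 0)(1 := a, 2 := b)"

text \<open>Only meaningful for \<open>j \<le> n\<close> and \<open>m \<le> n\<close>.\<close>

definition conn_coeff2 ::
    "(nat \<Rightarrow> nat) \<Rightarrow> (nat \<Rightarrow> real) \<Rightarrow> nat \<Rightarrow> nat \<Rightarrow> nat \<Rightarrow> real" where
  "conn_coeff2 \<tau> \<kappa> n j m = conn_coeff 2 \<tau> \<kappa> (pair_index (n - j) j) (pair_index (n - m) m)"

definition conn_const :: "real \<Rightarrow> real \<Rightarrow> real \<Rightarrow> nat \<Rightarrow> nat \<Rightarrow> nat \<Rightarrow> real" where
  "conn_const \<kappa>\<^sub>1 \<kappa>\<^sub>2 \<kappa>\<^sub>3 n j m =
     (-1) ^ (n + m) *
     (pochhammer (- real n) j * pochhammer (\<kappa>\<^sub>2 + 1) (n - j) * pochhammer (\<kappa>\<^sub>3 + 1) j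
       / (fact j * pochhammer (\<kappa>\<^sub>2 + 1) m)) *
     (pochhammer (real n + (\<kappa>\<^sub>1 + \<kappa>\<^sub>2 + \<kappa>\<^sub>3) + 2) m
       / (pochhammer (\<kappa>\<^sub>2 + \<kappa>\<^sub>3 + 2 * real m + 2) (n - m) *
          pochhammer (\<kappa>\<^sub>2 + \<kappa>\<^sub>3 + real m + 1) m))"

text \<open>
  The terminating hypergeometric sum over \<open>0 \<le> k \<le> N\<close>; the cut-off is explicit because
  lower parameters may be negative integers, whose Pochhammer symbols vanish beyond it.
\<close>

definition hypergeo_upto :: "nat \<Rightarrow> real list \<Rightarrow> real list \<Rightarrow> real \<Rightarrow> real" where
  "hypergeo_upto N as bs z = (\<Sum>k\<le>N. fps_nth (fps_hypergeo as bs z) k)"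

end

theory Submission
  imports Defs
begin

text \<open>
  The transposition \<open>(12)\<close> acts on the first two factors of the product that defines
  \<open>P\<^sub>\<nu>\<^sup>\<kappa>\<close>, and \<open>(34)\<close> acts on the third one. Indeed, for \<open>d = 3\<close> the first two factors form
  the two-variable polynomial with parameters \<open>(\<kappa>\<^sub>1, \<kappa>\<^sub>2, \<kappa>\<^sub>3 + \<kappa>\<^sub>4 + 2\<nu>\<^sub>3 + 1)\<close> in \<open>x\<^sub>1\<close>, \<open>x\<^sub>2\<close>,
  and the third factor is a binary form of degree \<open>\<nu>\<^sub>3\<close> in \<open>x\<^sub>3\<close> and \<open>x\<^sub>4 = 1 - x\<^sub>1 - x\<^sub>2 - x\<^sub>3\<close>
  (\<open>simplex_jacobi_3\<close>). Exchanging \<open>x\<^sub>1\<close> and \<open>x\<^sub>2\<close> together with their parameters leaves the third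
  factor alone, and exchanging \<open>x\<^sub>3\<close> and \<open>x\<^sub>4\<close> in the same way multiplies it by \<open>(-1)\<close> to the power \<open>\<nu>\<^sub>3\<close>, by the
  reflection formula for Jacobi polynomials. Since the polynomials \<open>P\<^sub>\<mu>\<^sup>\<kappa>\<close> with \<open>|\<mu>| = n\<close> are linearly
  independent (\<open>simplex_jacobi_independent\<close>), every expansion in them gives the connection
  coefficients (\<open>conn_coeff_eqI\<close>), and only the two-variable expansion \<open>ternary_form_swap\<close> remains.

  For this expansion, make the two-variable polynomials homogeneous by means of
  \<open>x\<^sub>1 + x\<^sub>2 + x\<^sub>3 = 1\<close> and write a form of degree \<open>n\<close> as the sum over \<open>a + b + c = n\<close> of
  \<open>g a b c\<close> times \<open>x\<^sub>1\<^sup>a x\<^sub>2\<^sup>b x\<^sub>3\<^sup>c / (a! (\<kappa>\<^sub>1+1)\<^sub>a b! (\<kappa>\<^sub>2+1)\<^sub>b c! (\<kappa>\<^sub>3+1)\<^sub>c)\<close>. The orthogonal polynomials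
  of degree \<open>n\<close> become the kernel of the operator
  \<open>\<Sum>\<^sub>i x\<^sub>i \<partial>\<^sub>i\<^sup>2 + (\<kappa>\<^sub>i + 1) \<partial>\<^sub>i\<close>, which in these coefficients reads
  \<open>g (a+1) b c + g a (b+1) c + g a b (c+1) = 0\<close>. The condition is symmetric in the three variables,
  and it determines \<open>g\<close> from the values \<open>g a b 0\<close>, that is, from the restriction of the form to the
  face \<open>x\<^sub>3 = 0\<close>. So the expansion has to be checked on that face only, where the coefficients of
  both bases are products of Pochhammer symbols. There the claim is an identity between a
  double sum and a product: the sum over the index \<open>m\<close> of the basis is a terminating very
  well-poised \<open>5F4\<close> (\<open>dougall_5F4\<close>), and the sum over the index \<open>k\<close> of the \<open>4F3\<close> that is left is
  a balanced \<open>3F2\<close> (\<open>saalschutz\<close>).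
\<close>

section \<open>Two terminating hypergeometric sums\<close>

lemma pochhammer_diff_Suc:
  "pochhammer (x + 1) n = pochhammer x n + of_nat n * pochhammer (x + 1) (n - 1)"
  for x :: "'a :: comm_ring_1"
proof (cases n)
  case (Suc m)
  show ?thesis unfolding Suc pochhammer_rec[of x] by (simp add: pochhammer_rec' algebra_simps)
qed simp

lemma sum_choose_Suc:
  fixes f :: "nat \<Rightarrow> 'a :: comm_semiring_1"
  shows "(\<Sum>k\<le>Suc n. of_nat (Suc n choose k) * f k) =
         (\<Sum>k\<le>n. of_nat (n choose k) * (f k + f (Suc k)))"
proof -
  have "(\<Sum>k\<le>Suc n. of_nat (Suc n choose k) * f k) =
      f 0 + ((\<Sum>k\<le>n. of_nat (n choose k) * f (Suc k)) + (\<Sum>k\<le>n. of_nat (n choose Suc k) * f (Suc k)))"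
    by (subst sum.atMost_Suc_shift) (simp add: sum.distrib[symmetric] distrib_right)
  also have "\<dots> = (\<Sum>k\<le>n. of_nat (n choose k) * f (Suc k)) + (\<Sum>k\<le>Suc n. of_nat (n choose k) * f k)"
    unfolding sum.atMost_Suc_shift[of "\<lambda>k. of_nat (n choose k) * f k"] by (simp add: add_ac)
  also have "(\<Sum>k\<le>Suc n. of_nat (n choose k) * f k) = (\<Sum>k\<le>n. of_nat (n choose k) * f k)"
    by (simp add: binomial_eq_0)
  finally show ?thesis by (simp add: sum.distrib[symmetric] distrib_left add.commute)
qed

text \<open>
  The Pfaff-Saalschuetz summation of a balanced \<open>3F2\<close> without denominators, so that it holds for all
  parameters. Pascal's rule reduces the sum of length \<open>n + 1\<close> to sums of length at most \<open>n\<close>, some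
  of them with \<open>c + 1\<close> in place of \<open>c\<close>; this is why \<open>c\<close> is arbitrary in the induction.
\<close>

lemma saalschutz:
  fixes a b c :: "'a :: comm_ring_1"
  shows "(\<Sum>k\<le>n. of_nat (n choose k) * pochhammer a k * pochhammer b k *
           pochhammer (c + of_nat k) (n - k) * pochhammer (c - a - b) (n - k)) =
         pochhammer (c - a) n * pochhammer (c - b) n"
proof (induction n arbitrary: c rule: less_induct)
  case (less n)
  show ?case
  proof (cases n)
    case 0
    then show ?thesis by simp
  next
    case (Suc N)
    define d where "d = c - a - b"
    define S where "S = (\<lambda>n (c::'a). \<Sum>k\<le>n. of_nat (n choose k) * pochhammer a k *
      pochhammer b k * pochhammer (c + of_nat k) (n - k) * pochhammer (c - a - b) (n - k))"
    define T where "T = (\<Sum>k\<le>N. of_nat (N choose k) * pochhammer a k * pochhammer b k *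
        pochhammer (c + 1 + of_nat k) (N - k) * pochhammer d (N - k))"
    let ?u = "\<lambda>n k. pochhammer a k * pochhammer b k *
        pochhammer (c + of_nat k) (n - k) * pochhammer d (n - k)"
    have IH: "S m c' = pochhammer (c' - a) m * pochhammer (c' - b) m" if "m \<le> N" for m c'
      unfolding S_def using less.IH[of m c'] that Suc by simp
    have pair: "?u (Suc N) k + ?u (Suc N) (Suc k) =
        ((c - a) * (c - b)) * (pochhammer a k * pochhammer b k *
          pochhammer (c + 1 + of_nat k) (N - k) * pochhammer d (N - k)) +
        of_nat N * (c + of_nat N) * ?u N k" if "k \<le> N" for k
    proof -
      have e: "Suc N - k = Suc (N - k)" using that by simp
      have s1: "pochhammer (c + of_nat k) (Suc (N - k)) =
          (c + of_nat k) * pochhammer (c + 1 + of_nat k) (N - k)"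
        by (simp add: pochhammer_rec add_ac)
      have s2: "(c + of_nat k) * pochhammer (c + 1 + of_nat k) (N - k) =
          (c + of_nat N) * pochhammer (c + of_nat k) (N - k)"
        using that by (simp add: s1[symmetric] pochhammer_rec' of_nat_diff)
      have s3: "pochhammer d (Suc (N - k)) = pochhammer d (N - k) * (d + of_nat N - of_nat k)"
        using that by (simp add: pochhammer_Suc of_nat_diff add_diff_eq)
      \<comment> \<open>The balancing condition \<open>d = c - a - b\<close> splits the coefficient into a part free of \<open>k\<close>
        and a multiple of \<open>c + k\<close>.\<close>
      have key: "(c + of_nat k) * (d + of_nat N - of_nat k) + (a + of_nat k) * (b + of_nat k) =
          (c - a) * (c - b) + of_nat N * (c + of_nat k)"
        unfolding d_def by (simp add: algebra_simps)
      have "?u (Suc N) k + ?u (Suc N) (Suc k) =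
          ((c + of_nat k) * (d + of_nat N - of_nat k) + (a + of_nat k) * (b + of_nat k)) *
          (pochhammer a k * pochhammer b k *
          pochhammer (c + 1 + of_nat k) (N - k) * pochhammer d (N - k))"
        unfolding e s1 s3 by (simp add: pochhammer_Suc add_ac algebra_simps)
      also have "\<dots> = ((c - a) * (c - b)) * (pochhammer a k * pochhammer b k *
          pochhammer (c + 1 + of_nat k) (N - k) * pochhammer d (N - k)) +
          of_nat N * ((c + of_nat k) * pochhammer (c + 1 + of_nat k) (N - k)) *
            (pochhammer a k * pochhammer b k * pochhammer d (N - k))"
        unfolding key by (simp add: algebra_simps)
      also have "\<dots> = ((c - a) * (c - b)) * (pochhammer a k * pochhammer b k *
          pochhammer (c + 1 + of_nat k) (N - k) * pochhammer d (N - k)) +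
          of_nat N * (c + of_nat N) * ?u N k"
        unfolding s2 by (simp add: mult_ac)
      finally show ?thesis .
    qed
    have step: "S (Suc N) c = (c - a) * (c - b) * T + of_nat N * (c + of_nat N) * S N c"
    proof -
      have "S (Suc N) c = (\<Sum>k\<le>Suc N. of_nat (Suc N choose k) * ?u (Suc N) k)"
        unfolding S_def d_def by (simp only: mult.assoc)
      also have "\<dots> = (\<Sum>k\<le>N. of_nat (N choose k) * (((c - a) * (c - b)) * (pochhammer a k *
          pochhammer b k * pochhammer (c + 1 + of_nat k) (N - k) * pochhammer d (N - k)) +
        of_nat N * (c + of_nat N) * ?u N k))"
        unfolding sum_choose_Suc by (intro sum.cong refl arg_cong2[where f = "(*)"] pair) simp
      also have "\<dots> = (c - a) * (c - b) * T + of_nat N * (c + of_nat N) * S N c"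
        unfolding T_def S_def d_def sum_distrib_left
        by (simp only: sum.distrib[symmetric] distrib_left mult_ac)
      finally show ?thesis .
    qed
    \<comment> \<open>The shifted sum \<open>T\<close> differs from \<open>S\<close> at \<open>c + 1\<close> by a sum of the same kind of length \<open>N - 1\<close>.\<close>
    have T: "T = S N (c + 1) - of_nat N * (c + of_nat N) * S (N - 1) (c + 1)"
    proof (cases N)
      case 0
      then show ?thesis by (simp add: T_def S_def)
    next
      case (Suc M)
      have abs: "of_nat (N choose k) * of_nat (N - k) = of_nat N * (of_nat (M choose k) :: 'a)"
        for k
        using binomial_absorb_comp[of N k] Suc by (metis diff_Suc_1 mult.commute of_nat_mult)
      have "S N (c + 1) - T = (\<Sum>k\<le>N. of_nat (N choose k) * of_nat (N - k) *
         (pochhammer a k * pochhammer b k * pochhammer (c + 1 + of_nat k) (N - k) *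
          pochhammer (d + 1) (N - k - 1)))"
      proof -
        have e: "c + 1 - a - b = d + 1" by (simp add: d_def)
        have D: "pochhammer (d + 1) (N - k) =
            pochhammer d (N - k) + of_nat (N - k) * pochhammer (d + 1) (N - k - 1)" for k
          by (rule pochhammer_diff_Suc)
        have "S N (c + 1) - T = (\<Sum>k\<le>N. of_nat (N choose k) * (pochhammer a k * pochhammer b k *
            pochhammer (c + 1 + of_nat k) (N - k)) *
            (pochhammer (d + 1) (N - k) - pochhammer d (N - k)))"
          unfolding S_def T_def e sum_subtractf[symmetric] by (simp add: algebra_simps)
        then show ?thesis unfolding D by (simp add: mult_ac)
      qed
      also have "\<dots> = (\<Sum>k\<le>N. of_nat N * of_nat (M choose k) *
         (pochhammer a k * pochhammer b k * pochhammer (c + 1 + of_nat k) (N - k) *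
          pochhammer (d + 1) (N - k - 1)))"
        unfolding abs ..
      also have "\<dots> = (\<Sum>k\<le>M. of_nat N * of_nat (M choose k) *
         (pochhammer a k * pochhammer b k * pochhammer (c + 1 + of_nat k) (N - k) *
          pochhammer (d + 1) (N - k - 1)))"
        by (simp add: Suc binomial_eq_0)
      also have "\<dots> = (\<Sum>k\<le>M. of_nat N * (c + of_nat N) * (of_nat (M choose k) *
         pochhammer a k * pochhammer b k * pochhammer (c + 1 + of_nat k) (M - k) *
          pochhammer (c + 1 - a - b) (M - k)))"
      proof (intro sum.cong refl)
        fix k assume "k \<in> {..M}"
        then have k: "k \<le> M" by simp
        have e: "N - k = Suc (M - k)" "N - k - 1 = M - k" "c + 1 - a - b = d + 1"
          using k by (auto simp: Suc d_def)
        have "pochhammer (c + 1 + of_nat k) (N - k) =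
            pochhammer (c + 1 + of_nat k) (M - k) * (c + of_nat N)"
          using k unfolding e by (simp add: pochhammer_Suc Suc of_nat_diff algebra_simps)
        then show "of_nat N * of_nat (M choose k) *
         (pochhammer a k * pochhammer b k * pochhammer (c + 1 + of_nat k) (N - k) *
          pochhammer (d + 1) (N - k - 1)) = of_nat N * (c + of_nat N) * (of_nat (M choose k) *
         pochhammer a k * pochhammer b k * pochhammer (c + 1 + of_nat k) (M - k) *
          pochhammer (c + 1 - a - b) (M - k))"
          unfolding e(2,3) by (simp only: mult_ac)
      qed
      also have "\<dots> = of_nat N * (c + of_nat N) * S (N - 1) (c + 1)"
        unfolding S_def sum_distrib_left Suc by simp
      finally show ?thesis by (simp add: algebra_simps)
    qed
    have shift: "(x - y) * pochhammer (x + 1 - y) m = pochhammer (x - y) m * (x - y + of_nat m)"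
      for x y :: 'a and m
      using pochhammer_rec[of "x - y" m] pochhammer_Suc[of "x - y" m] by (simp add: algebra_simps)
    have A: "(c - a) * (c - b) * S N (c + 1) =
        pochhammer (c - a) N * pochhammer (c - b) N * ((c - a + of_nat N) * (c - b + of_nat N))"
    proof -
      have "(c - a) * (c - b) * S N (c + 1) =
          ((c - a) * pochhammer (c + 1 - a) N) * ((c - b) * pochhammer (c + 1 - b) N)"
        unfolding IH[OF order.refl] by (simp only: mult_ac)
      then show ?thesis unfolding shift by (simp only: mult_ac)
    qed
    have B: "of_nat N * ((c - a) * (c - b) * S (N - 1) (c + 1)) =
        of_nat N * (pochhammer (c - a) N * pochhammer (c - b) N)"
    proof (cases N)
      case (Suc M)
      show ?thesis
        using IH[of "N - 1" "c + 1"] by (simp add: Suc pochhammer_rec[of "c - a"]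
          pochhammer_rec[of "c - b"] algebra_simps)
    qed simp
    have "S (Suc N) c = (c - a) * (c - b) * S N (c + 1)
        - (c + of_nat N) * (of_nat N * ((c - a) * (c - b) * S (N - 1) (c + 1)))
        + of_nat N * (c + of_nat N) * (pochhammer (c - a) N * pochhammer (c - b) N)"
      unfolding step T IH[OF order.refl] by (simp add: algebra_simps)
    also have "\<dots> = pochhammer (c - a) (Suc N) * pochhammer (c - b) (Suc N)"
      unfolding A B pochhammer_Suc by (simp add: algebra_simps)
    finally show ?thesis unfolding S_def Suc .
  qed
qed

text \<open>
  Up to a constant factor this is the weight of the node \<open>m (m + a)\<close> in the divided difference over
  the nodes \<open>i (i + a)\<close>, \<open>i \<le> N\<close>. The closed form \<open>(a + 2m) / (a + m)\<^sub>N\<^sub>+\<^sub>1\<close> of the reciprocal of the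
  node differences is \<open>0 / 0\<close> at \<open>a = m = 0\<close>; here the factor \<open>a + 2m\<close> is cancelled.
\<close>

definition wp_weight :: "nat \<Rightarrow> real \<Rightarrow> nat \<Rightarrow> real" where
  "wp_weight N a m = (-1) ^ m * real (N choose m) /
     (pochhammer (a + real m) m * pochhammer (a + 2 * real m + 1) (N - m))"

lemma wp_weight_0: "a > -1 \<Longrightarrow> (a + real N + 1) * wp_weight (Suc N) a 0 = wp_weight N a 0"
  using pochhammer_pos[of "a + 1" N]
  by (simp add: wp_weight_def pochhammer_Suc divide_simps add_ac) 

lemma wp_weight_Suc:
  assumes a: "a > -1" and m: "m \<le> N"
  shows "(a + real N + 1) * wp_weight (Suc N) a (Suc m) =
         wp_weight N a (Suc m) - wp_weight N (a + 2) m"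
proof (cases "m = N")
  case True
  have "pochhammer (a + (real N + 1)) (Suc N) = (a + real N + 1) * pochhammer (a + 2 + real N) N"
    by (simp add: pochhammer_rec add_ac)
  moreover have "pochhammer (a + 2 + real N) N > 0" "a + real N + 1 > 0"
    using a by (auto intro!: pochhammer_pos)
  ultimately show ?thesis by (simp add: True wp_weight_def add_ac)
next
  case False
  with m obtain l where N: "N = Suc (m + l)" by (metis less_iff_Suc_add le_neq_implies_less)
  define P Q where "P = pochhammer (a + real m + 2) m" and "Q = pochhammer (a + 2 * real m + 3) l"
  have pos: "P > 0" "Q > 0" "a + real m + 1 > 0" "a + real m + real N + 2 > 0"
    using a by (auto simp: P_def Q_def intro!: pochhammer_pos)
  have e1: "pochhammer (a + real (Suc m)) (Suc m) = (a + real m + 1) * P"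
    by (simp add: P_def pochhammer_rec add_ac)
  have e2: "pochhammer (a + 2 * real (Suc m) + 1) (Suc N - Suc m) = Q * (a + real m + real N + 2)"
    by (simp add: Q_def N pochhammer_Suc add_ac)
  have e3: "pochhammer (a + 2 * real (Suc m) + 1) (N - Suc m) = Q"
    by (simp add: Q_def N add_ac)
  have e4: "pochhammer (a + 2 + real m) m = P" by (simp add: P_def add_ac)
  have e5: "pochhammer (a + 2 + 2 * real m + 1) (N - m) = Q * (a + real m + real N + 2)"
    by (simp add: Q_def N pochhammer_Suc add_ac)
  have "Suc m * (N choose Suc m) = (N - m) * (N choose m)"
    using binomial_absorption binomial_absorb_comp by (metis N diff_Suc_1 binomial_absorption)
  then have "real (Suc m * (N choose Suc m)) = real ((N - m) * (N choose m))" by simp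
  then have absorb: "(real m + 1) * real (N choose Suc m) = (real N - real m) * real (N choose m)"
    using m by (simp add: of_nat_diff algebra_simps)
  have key: "(a + real N + 1) * (u + v) = v * (a + real m + real N + 2) + u * (a + real m + 1)"
    if "(real m + 1) * v = (real N - real m) * u" for u v
    using that by algebra
  define s :: real where "s = (-1) ^ m"
  show ?thesis
    unfolding wp_weight_def e1 e2 e3 e4 e5 power_Suc s_def[symmetric]
    using pos by (simp add: divide_simps) (use key[OF absorb] in algebra)
qed

text \<open>
  The recurrence of divided differences: the nodes \<open>1, \<dots>, N + 1\<close> for the parameter \<open>a\<close> are, up to a
  translation, the nodes \<open>0, \<dots>, N\<close> for \<open>a + 2\<close>.
\<close>

lemma sum_wp_weight_Suc:
  assumes a: "a > -1"
  shows "(a + real N + 1) * (\<Sum>m\<le>Suc N. wp_weight (Suc N) a m * f m) =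
         (\<Sum>m\<le>N. wp_weight N a m * f m) - (\<Sum>m\<le>N. wp_weight N (a + 2) m * f (Suc m))"
proof -
  have "(a + real N + 1) * (\<Sum>m\<le>Suc N. wp_weight (Suc N) a m * f m) =
      ((a + real N + 1) * wp_weight (Suc N) a 0) * f 0 +
      (\<Sum>m\<le>N. ((a + real N + 1) * wp_weight (Suc N) a (Suc m)) * f (Suc m))"
    by (simp add: sum.atMost_Suc_shift sum_distrib_left distrib_left mult_ac del: sum.atMost_Suc)
  also have "\<dots> = wp_weight N a 0 * f 0 +
      (\<Sum>m\<le>N. (wp_weight N a (Suc m) - wp_weight N (a + 2) m) * f (Suc m))"
    using wp_weight_0[OF a] wp_weight_Suc[OF a] by simp
  also have "\<dots> = (\<Sum>m\<le>Suc N. wp_weight N a m * f m) - (\<Sum>m\<le>N. wp_weight N (a + 2) m * f (Suc m))"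
    by (simp add: sum.atMost_Suc_shift sum_subtractf left_diff_distrib del: sum.atMost_Suc)
  also have "wp_weight N a (Suc N) = 0" by (simp add: wp_weight_def binomial_eq_0)
  then have "(\<Sum>m\<le>Suc N. wp_weight N a m * f m) = (\<Sum>m\<le>N. wp_weight N a m * f m)" by simp
  finally show ?thesis .
qed

text \<open>
  The terminating very well-poised \<open>5F4\<close>. The recurrence of the weights changes \<open>(a, b, c)\<close> into
  \<open>(a + 2, b + 1, c + 1)\<close>, which keeps \<open>1 + a - b - c\<close> fixed, so both terms of the
  induction step have the same numerator.
\<close>

lemma dougall_5F4:
  assumes "a > -1" "pochhammer (1 + a - b) N \<noteq> 0" "pochhammer (1 + a - c) N \<noteq> 0"
  shows "(\<Sum>m\<le>N. wp_weight N a m * (pochhammer b m * pochhammer c m /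
             (pochhammer (1 + a - b) m * pochhammer (1 + a - c) m))) =
         pochhammer (1 + a - b - c) N / (pochhammer (1 + a - b) N * pochhammer (1 + a - c) N)"
  using assms
proof (induction N arbitrary: a b c)
  case 0
  then show ?case by (simp add: wp_weight_def)
next
  case (Suc N)
  let ?f = "\<lambda>a b c m. pochhammer b m * pochhammer c m /
             (pochhammer (1 + a - b) m * pochhammer (1 + a - c) m)"
  define p q where "p = 1 + a - b" and "q = 1 + a - c"
  have nz: "pochhammer p N \<noteq> 0" "pochhammer q N \<noteq> 0" "p + real N \<noteq> 0" "q + real N \<noteq> 0"
    "p \<noteq> 0" "q \<noteq> 0" "pochhammer (p + 1) N \<noteq> 0" "pochhammer (q + 1) N \<noteq> 0"
    using Suc.prems(2,3) pochhammer_rec[of p N] pochhammer_rec[of q N]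
      pochhammer_Suc[of p N] pochhammer_Suc[of q N]
    unfolding p_def[symmetric] q_def[symmetric] by auto
  have shifted: "1 + (a + 2) - (b + 1) = p + 1" "1 + (a + 2) - (c + 1) = q + 1"
    "p + 1 - (c + 1) = 1 + a - b - c"
    by (simp_all add: p_def q_def)
  have f_Suc: "?f a b c (Suc m) = b * c / (p * q) * ?f (a + 2) (b + 1) (c + 1) m" for m
    unfolding shifted unfolding p_def[symmetric] q_def[symmetric] pochhammer_rec by (simp add: mult_ac)
  have "(a + real N + 1) * (\<Sum>m\<le>Suc N. wp_weight (Suc N) a m * ?f a b c m) =
      (\<Sum>m\<le>N. wp_weight N a m * ?f a b c m) -
      b * c / (p * q) * (\<Sum>m\<le>N. wp_weight N (a + 2) m * ?f (a + 2) (b + 1) (c + 1) m)"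
    unfolding sum_wp_weight_Suc[OF Suc.prems(1)] f_Suc
    by (subst sum_distrib_left) (simp only: mult_ac)
  also have "(\<Sum>m\<le>N. wp_weight N a m * ?f a b c m) =
      pochhammer (1 + a - b - c) N / (pochhammer p N * pochhammer q N)"
    unfolding p_def q_def
    by (rule Suc.IH) (use Suc.prems nz in \<open>auto simp: p_def q_def\<close>)
  also have "(\<Sum>m\<le>N. wp_weight N (a + 2) m * ?f (a + 2) (b + 1) (c + 1) m) =
      pochhammer (1 + a - b - c) N / (pochhammer (p + 1) N * pochhammer (q + 1) N)"
    using Suc.IH[of "a + 2" "b + 1" "c + 1"] Suc.prems(1) nz(7,8) unfolding shifted by simp
  also have "b * c / (p * q) *
        (pochhammer (1 + a - b - c) N / (pochhammer (p + 1) N * pochhammer (q + 1) N)) =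
      b * c * pochhammer (1 + a - b - c) N / (pochhammer p (Suc N) * pochhammer q (Suc N))"
    by (simp add: pochhammer_rec)
  also have "pochhammer (1 + a - b - c) N / (pochhammer p N * pochhammer q N) =
      (p + real N) * (q + real N) * pochhammer (1 + a - b - c) N /
        (pochhammer p (Suc N) * pochhammer q (Suc N))"
    using nz by (simp add: pochhammer_Suc)
  also have "\<dots> - b * c * pochhammer (1 + a - b - c) N / (pochhammer p (Suc N) * pochhammer q (Suc N)) =
      ((p + real N) * (q + real N) - b * c) * pochhammer (1 + a - b - c) N /
        (pochhammer p (Suc N) * pochhammer q (Suc N))"
    by (simp add: diff_divide_distrib left_diff_distrib)
  also have "(p + real N) * (q + real N) - b * c = (a + real N + 1) * (1 + a - b - c + real N)"
    by (simp add: p_def q_def algebra_simps)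
  finally have "(a + real N + 1) * (\<Sum>m\<le>Suc N. wp_weight (Suc N) a m * ?f a b c m) =
      (a + real N + 1) * (pochhammer (1 + a - b - c) (Suc N) /
        (pochhammer p (Suc N) * pochhammer q (Suc N)))"
    by (simp add: pochhammer_Suc mult_ac)
  moreover have "a + real N + 1 \<noteq> 0" using Suc.prems(1) by simp
  ultimately show ?case unfolding p_def q_def using mult_left_cancel by blast
qed

section \<open>Jacobi polynomials as binary forms\<close>

lemma sum_triangle:
  fixes g :: "nat \<Rightarrow> nat \<Rightarrow> 'a :: comm_monoid_add"
  shows "(\<Sum>i\<le>n. \<Sum>j\<le>n - i. g i j) = (\<Sum>(i, j)\<in>{(i, j). i + j \<le> n}. g i j)"
proof -
  have "{(i, j). i + j \<le> n} = Sigma {..n} (\<lambda>i. {..n - i})" by auto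
  then show ?thesis by (simp add: sum.Sigma)
qed

text \<open>
  The Jacobi polynomial as a binary form in \<open>u = s (1 - x) / 2\<close> and \<open>t = s (1 + x) / 2\<close>.
  In these variables the exchange of \<open>\<alpha>\<close> and \<open>\<beta>\<close> is visible.
\<close>

definition jacobi_form :: "nat \<Rightarrow> real \<Rightarrow> real \<Rightarrow> real \<Rightarrow> real \<Rightarrow> real" where
  "jacobi_form n \<alpha> \<beta> u t = (\<Sum>i\<le>n. (-1) ^ i *
     (pochhammer (\<alpha> + real i + 1) (n - i) / fact (n - i)) *
     (pochhammer (\<beta> + real (n - i) + 1) i / fact i) * u ^ i * t ^ (n - i))"

lemma jacobi_form_swap: "jacobi_form n \<alpha> \<beta> u t = (-1) ^ n * jacobi_form n \<beta> \<alpha> t u"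
proof -
  have sgn: "(-1) ^ n * ((-1) ^ (n - i) * x) = (-1) ^ i * x" if "i \<le> n" for i and x :: real
    using that by (simp add: mult.assoc[symmetric] power_add[symmetric] minus_one_power_iff)
  show ?thesis
    unfolding jacobi_form_def sum_distrib_left
    by (intro sum.reindex_bij_witness[of _ "\<lambda>i. n - i" "\<lambda>i. n - i"])
       (auto simp: mult.assoc sgn mult.left_commute mult.commute)
qed

lemma vandermonde_pochhammer:
  fixes \<alpha> \<beta> :: real
  assumes "l \<le> n"
  shows "(\<Sum>i\<le>l. real (l choose i) * pochhammer (\<alpha> + real i + 1) (l - i) *
            pochhammer (\<beta> + real (n - i) + 1) i) = pochhammer (real n + \<alpha> + \<beta> + 1) l"
proof -
  have "pochhammer (real n + \<alpha> + \<beta> + 1) l / fact l = (\<beta> + real n + (\<alpha> + real l)) gchoose l"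
    unfolding gbinomial_pochhammer' by (simp add: algebra_simps)
  also have "\<dots> = (\<Sum>i\<le>l. ((\<beta> + real n) gchoose i) * ((\<alpha> + real l) gchoose (l - i)))"
    unfolding gbinomial_Vandermonde[symmetric] by (simp add: atLeast0AtMost)
  also have "\<dots> = (\<Sum>i\<le>l. real (l choose i) * pochhammer (\<alpha> + real i + 1) (l - i) *
            pochhammer (\<beta> + real (n - i) + 1) i / fact l)"
  proof (intro sum.cong refl)
    fix i assume "i \<in> {..l}"
    then have i: "i \<le> l" "i \<le> n" using assms by auto
    then show "((\<beta> + real n) gchoose i) * ((\<alpha> + real l) gchoose (l - i)) =
        real (l choose i) * pochhammer (\<alpha> + real i + 1) (l - i) *
            pochhammer (\<beta> + real (n - i) + 1) i / fact l"
      unfolding gbinomial_pochhammer' by (simp add: binomial_fact of_nat_diff algebra_simps)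
  qed
  finally show ?thesis unfolding sum_divide_distrib[symmetric] by simp
qed

text \<open>
  Expanding \<open>(1 - u)\<close> to the power \<open>n - i\<close> and collecting powers of \<open>u\<close> gives a Vandermonde sum
  for each coefficient.
\<close>

lemma poly_jacobi_eq: "poly (jacobi n \<alpha> \<beta>) (1 - 2 * u) = jacobi_form n \<alpha> \<beta> u (1 - u)"
proof -
  define C where "C = (\<lambda>i. (pochhammer (\<alpha> + real i + 1) (n - i) / fact (n - i)) *
     (pochhammer (\<beta> + real (n - i) + 1) i / fact i))"
  have "jacobi_form n \<alpha> \<beta> u (1 - u) = (\<Sum>i\<le>n. C i * (-u) ^ i * (- u + 1) ^ (n - i))"
    unfolding jacobi_form_def C_def
    by (intro sum.cong refl) (simp add: power_minus[of u] mult_ac)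
  also have "\<dots> = (\<Sum>i\<le>n. \<Sum>j\<le>n - i. C i * real (n - i choose j) * (-u) ^ (i + j))"
    unfolding binomial_ring sum_distrib_left
    by (intro sum.cong refl) (simp add: power_add mult_ac)
  also have "\<dots> = (\<Sum>l\<le>n. \<Sum>i\<le>l. C i * real (n - i choose (l - i)) * (-u) ^ (i + (l - i)))"
    unfolding sum_triangle by (rule sum.triangle_reindex_eq)
  also have "\<dots> = (\<Sum>l\<le>n. pochhammer (real n + \<alpha> + \<beta> + 1) l * pochhammer (\<alpha> + real l + 1) (n - l)
              / (fact l * fact (n - l)) * (- u) ^ l)"
  proof (intro sum.cong refl)
    fix l assume "l \<in> {..n}"
    then have l: "l \<le> n" by simp
    have "(\<Sum>i\<le>l. C i * real (n - i choose (l - i)) * (-u) ^ (i + (l - i))) =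
        (\<Sum>i\<le>l. real (l choose i) * pochhammer (\<alpha> + real i + 1) (l - i) *
            pochhammer (\<beta> + real (n - i) + 1) i * (pochhammer (\<alpha> + real l + 1) (n - l)
              / (fact l * fact (n - l)) * (- u) ^ l))"
    proof (intro sum.cong refl)
      fix i assume "i \<in> {..l}"
      then have i: "i \<le> l" "i \<le> n" using l by auto
      have "pochhammer (\<alpha> + real i + 1) (n - i) =
          pochhammer (\<alpha> + real i + 1) (l - i) * pochhammer (\<alpha> + real l + 1) (n - l)"
        using pochhammer_product[of "l - i" "n - i" "\<alpha> + real i + 1"] i l
        by (simp add: of_nat_diff algebra_simps)
      then show "C i * real (n - i choose (l - i)) * (-u) ^ (i + (l - i)) =
          real (l choose i) * pochhammer (\<alpha> + real i + 1) (l - i) *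
            pochhammer (\<beta> + real (n - i) + 1) i * (pochhammer (\<alpha> + real l + 1) (n - l)
              / (fact l * fact (n - l)) * (- u) ^ l)"
        using i l unfolding C_def by (simp add: binomial_fact field_simps)
    qed
    also have "\<dots> = pochhammer (real n + \<alpha> + \<beta> + 1) l * pochhammer (\<alpha> + real l + 1) (n - l)
              / (fact l * fact (n - l)) * (- u) ^ l"
      unfolding sum_distrib_right[symmetric] vandermonde_pochhammer[OF l] by simp
    finally show "(\<Sum>i\<le>l. C i * real (n - i choose (l - i)) * (-u) ^ (i + (l - i))) =
        pochhammer (real n + \<alpha> + \<beta> + 1) l * pochhammer (\<alpha> + real l + 1) (n - l)
              / (fact l * fact (n - l)) * (- u) ^ l" .
  qed
  also have "\<dots> = poly (jacobi n \<alpha> \<beta>) (1 - 2 * u)"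
  proof -
    have "poly [:-1/2, 1/2:] (1 - 2 * u) = - u" by (simp add: field_simps)
    then show ?thesis unfolding jacobi_def poly_sum poly_smult poly_power by simp
  qed
  finally show ?thesis ..
qed

lemma jacobi_form_scale: "s ^ n * jacobi_form n \<alpha> \<beta> u t = jacobi_form n \<alpha> \<beta> (s * u) (s * t)"
proof -
  have "s ^ n = s ^ i * s ^ (n - i)" if "i \<le> n" for i
    using that by (simp flip: power_add)
  then show ?thesis
    unfolding jacobi_form_def sum_distrib_left
    by (intro sum.cong refl) (simp add: power_mult_distrib mult_ac)
qed

text \<open>
  For \<open>s \<noteq> 0\<close> this is the previous expansion, scaled; the value at \<open>s = 0\<close> follows by continuity in \<open>s\<close>.
\<close>

lemma homog_jacobi:
  "homog n (pcompose (jacobi n \<alpha> \<beta>) [:-1, 2:]) s t = jacobi_form n \<alpha> \<beta> (s - t) t"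
proof -
  let ?p = "pcompose (jacobi n \<alpha> \<beta>) [:-1, 2:]"
  have deg: "degree ?p \<le> n"
    using degree_pcompose_le[of "jacobi n \<alpha> \<beta>" "[:-1, 2:]"] degree_jacobi_le[of n \<alpha> \<beta>]
    by (simp add: le_trans)
  have nz: "homog n ?p s t = jacobi_form n \<alpha> \<beta> (s - t) t" if "s \<noteq> 0" for s
  proof -
    have "homog n ?p s t = s ^ n * poly (jacobi n \<alpha> \<beta>) (1 - 2 * (1 - t / s))"
      using that by (simp add: homog_eq[OF deg] poly_pcompose mult.commute)
    also have "\<dots> = jacobi_form n \<alpha> \<beta> (s * (1 - t / s)) (s * (1 - (1 - t / s)))"
      unfolding poly_jacobi_eq jacobi_form_scale ..
    also have "\<dots> = jacobi_form n \<alpha> \<beta> (s - t) t"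
      using that by (simp add: right_diff_distrib)
    finally show ?thesis .
  qed
  show ?thesis
  proof (cases "s = 0")
    case True
    have "isCont (\<lambda>s. homog n ?p s t - jacobi_form n \<alpha> \<beta> (s - t) t) 0"
      unfolding homog_def jacobi_form_def by (intro continuous_intros)
    then have "((\<lambda>s. homog n ?p s t - jacobi_form n \<alpha> \<beta> (s - t) t) \<longlongrightarrow>
        homog n ?p 0 t - jacobi_form n \<alpha> \<beta> (0 - t) t) (at 0)"
      by (simp add: isCont_def)
    moreover have "((\<lambda>s. homog n ?p s t - jacobi_form n \<alpha> \<beta> (s - t) t) \<longlongrightarrow> 0) (at 0)"
      by (rule tendsto_eventually) (auto simp: eventually_at_filter nz)
    ultimately have "homog n ?p 0 t - jacobi_form n \<alpha> \<beta> (0 - t) t = 0"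
      by (rule tendsto_unique[OF at_neq_bot])
    then show ?thesis using True by simp
  qed (rule nz)
qed

section \<open>Linear independence of the simplex polynomials\<close>

lemma finite_multi_indices: "finite (multi_indices d n)"
proof (rule finite_subset)
  show "multi_indices d n \<subseteq> {f. \<forall>i. (i \<in> {1..d} \<longrightarrow> f i \<in> {..n}) \<and> (i \<notin> {1..d} \<longrightarrow> f i = 0)}"
  proof
    fix \<mu> assume \<mu>: "\<mu> \<in> multi_indices d n"
    have "\<mu> i \<le> n" if "i \<in> {1..d}" for i
      using member_le_sum[of i "{1..d}" \<mu>] that \<mu> by (auto simp: multi_indices_def)
    then show "\<mu> \<in> {f. \<forall>i. (i \<in> {1..d} \<longrightarrow> f i \<in> {..n}) \<and> (i \<notin> {1..d} \<longrightarrow> f i = 0)}"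
      using \<mu> by (auto simp: multi_indices_def)
  qed
  show "finite {f. \<forall>i. (i \<in> {1..d} \<longrightarrow> f i \<in> {..n}) \<and> (i \<notin> {1..d} \<longrightarrow> f i = (0::nat))}"
    by (rule finite_set_of_finite_funs) auto
qed

lemma base_expansion_unique:
  fixes f g :: "nat \<Rightarrow> nat"
  assumes "\<And>j. j < d \<Longrightarrow> f j < B" "\<And>j. j < d \<Longrightarrow> g j < B"
    and "(\<Sum>j<d. f j * B ^ j) = (\<Sum>j<d. g j * B ^ j)" "j < d"
  shows "f j = g j"
  using assms
proof (induction d arbitrary: f g j)
  case (Suc d)
  have split: "(\<Sum>j<Suc d. h j * B ^ j) = h 0 + B * (\<Sum>j<d. h (Suc j) * B ^ j)" for h :: "nat \<Rightarrow> nat"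
    by (simp add: sum.lessThan_Suc_shift sum_distrib_left mult_ac del: sum.lessThan_Suc)
  have eq: "f 0 + B * (\<Sum>j<d. f (Suc j) * B ^ j) = g 0 + B * (\<Sum>j<d. g (Suc j) * B ^ j)"
    using Suc.prems(3) unfolding split .
  have lt: "f 0 < B" "g 0 < B" using Suc.prems(1,2) by auto
  have f0: "f 0 = g 0" using arg_cong[OF eq, of "\<lambda>x. x mod B"] lt by simp
  then have "(\<Sum>j<d. f (Suc j) * B ^ j) = (\<Sum>j<d. g (Suc j) * B ^ j)"
    using eq lt by simp
  then have "f (Suc i) = g (Suc i)" if "i < d" for i
    using Suc.IH[of "\<lambda>j. f (Suc j)" "\<lambda>j. g (Suc j)" i] Suc.prems(1,2) that by simp
  then show ?case using f0 Suc.prems(4) by (cases j) auto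
qed simp

lemma jacobi_index_gt:
  assumes "\<And>i. i \<in> {1..d + 1} \<Longrightarrow> \<kappa> i > -1" and "j \<in> {1..d}"
  shows "jacobi_index d \<kappa> \<nu> j > -1"
proof -
  have "(\<Sum>i=j+1..d+1. - 1) < (\<Sum>i=j+1..d+1. \<kappa> i)"
    by (rule sum_strict_mono) (use assms in auto)
  then have "- real (d + 1 - j) < (\<Sum>i=j+1..d+1. \<kappa> i)" using assms(2) by simp
  moreover have "real (\<Sum>i=j+1..d. \<nu> i) \<ge> 0" by (rule of_nat_0_le_iff)
  ultimately show ?thesis using assms(2) unfolding jacobi_index_def by simp
qed

text \<open>
  For \<open>B \<ge> 2\<close>, a curve through the vertex \<open>(1, 0, \<dots>, 0)\<close>, reached at \<open>t = 0\<close>, along which each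
  \<open>1 - (x\<^sub>1 + \<dots> + x\<^sub>j)\<close> is a power of \<open>t\<close>. On it the \<open>j\<close>-th Jacobi factor has an argument that tends
  to \<open>1\<close>, and the powers of \<open>1 - (x\<^sub>1 + \<dots> + x\<^sub>j\<^sub>-\<^sub>1)\<close> give a power of \<open>t\<close> whose exponent encodes the
  multi-index in base \<open>B\<close>.
\<close>

definition monomial_curve :: "nat \<Rightarrow> real \<Rightarrow> nat \<Rightarrow> real" where
  "monomial_curve B t j = t ^ (B ^ j - B) - t ^ (B ^ Suc j - B)"

lemma sum_monomial_curve:
  "j \<ge> 1 \<Longrightarrow> 1 - (\<Sum>i=1..<j. monomial_curve B t i) = t ^ (B ^ j - B)"
  by (induction j rule: nat_induct_at_least) (auto simp: monomial_curve_def)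

text \<open>
  The order of vanishing at \<open>t = 0\<close> is exactly the stated exponent because \<open>coeff q 0\<close> is a
  product of values of Jacobi polynomials at \<open>1\<close>, which are positive for parameters above \<open>-1\<close>.
\<close>

lemma simplex_jacobi_monomial_curve:
  assumes \<kappa>: "\<And>i. i \<in> {1..d + 1} \<Longrightarrow> \<kappa> i > -1" and B: "B \<ge> 2"
  shows "\<exists>q. coeff q 0 \<noteq> 0 \<and> (\<forall>t. simplex_jacobi d \<kappa> \<mu> (monomial_curve B t) =
      t ^ (\<Sum>j=1..d. \<mu> j * (B ^ j - B)) * poly q t)"
proof -
  define w where "w = (\<lambda>j. B ^ Suc j - B ^ j)"
  define p where "p = (\<lambda>j. jacobi (\<mu> j) (jacobi_index d \<kappa> \<mu> j) (\<kappa> j))"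
  define q where "q = (\<Prod>j=1..d. pcompose (p j) (1 - monom 2 (w j)))"
  have mono: "B ^ j < B ^ Suc j" for j using B by (intro power_strict_increasing) auto
  then have w_pos: "w j > 0" for j by (simp add: w_def)
  have B_le: "B \<le> B ^ j" if "j \<ge> 1" for j
    using power_increasing[of 1 j B] that B by simp
  have p_1: "poly (p j) 1 \<noteq> 0" if "j \<in> {1..d}" for j
  proof -
    have "jacobi_index d \<kappa> \<mu> j > -1" by (rule jacobi_index_gt[OF \<kappa> that])
    then have "pochhammer (jacobi_index d \<kappa> \<mu> j + 1) (\<mu> j) > 0" by (intro pochhammer_pos) simp
    then show ?thesis by (simp add: p_def poly_jacobi_1)
  qed
  have "poly q 0 \<noteq> 0"
    using p_1 w_pos by (simp add: q_def poly_prod poly_pcompose poly_monom zero_power)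
  moreover have "simplex_jacobi d \<kappa> \<mu> (monomial_curve B t) =
      t ^ (\<Sum>j=1..d. \<mu> j * (B ^ j - B)) * poly q t" for t
  proof -
    have "simplex_jacobi d \<kappa> \<mu> (monomial_curve B t) =
        (\<Prod>j=1..d. t ^ (\<mu> j * (B ^ j - B)) * poly (p j) (1 - 2 * t ^ w j))"
      unfolding simplex_jacobi_def
    proof (intro prod.cong refl)
      fix j assume "j \<in> {1..d}"
      then have j: "j \<ge> 1" by simp
      let ?W = "B ^ j - B"
      have "B ^ Suc j - B = ?W + w j" using B_le[OF j] mono[of j] by (simp add: w_def)
      then have curve: "monomial_curve B t j = t ^ ?W * (1 - t ^ w j)"
          "t ^ ?W - t ^ ?W * (1 - t ^ w j) = t ^ ?W * t ^ w j"
        by (simp_all add: monomial_curve_def power_add right_diff_distrib)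
      show "homog (\<mu> j) (pcompose (jacobi (\<mu> j) (jacobi_index d \<kappa> \<mu> j) (\<kappa> j)) [:-1, 2:])
          (1 - (\<Sum>i=1..<j. monomial_curve B t i)) (monomial_curve B t j) =
        t ^ (\<mu> j * ?W) * poly (p j) (1 - 2 * t ^ w j)"
        unfolding homog_jacobi sum_monomial_curve[OF j] curve jacobi_form_scale[symmetric]
          p_def poly_jacobi_eq by (simp add: power_mult[symmetric] mult.commute)
    qed
    then show ?thesis
      by (simp add: q_def prod.distrib power_sum poly_prod poly_pcompose poly_monom)
  qed
  ultimately show ?thesis by (auto simp: poly_0_coeff_0)
qed

text \<open>
  Adding \<open>n B\<close> to the exponent turns it into the number with base-\<open>B\<close> digits \<open>\<mu> j\<close>.
\<close>

lemma monomial_curve_order_inj: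
  assumes \<mu>: "\<mu> \<in> multi_indices d n" and \<nu>: "\<nu> \<in> multi_indices d n" and B: "B > n"
    and eq: "(\<Sum>j=1..d. \<mu> j * (B ^ j - B)) = (\<Sum>j=1..d. \<nu> j * (B ^ j - B))"
  shows "\<mu> = \<nu>"
proof -
  have expand: "(\<Sum>j=1..d. h j * (B ^ j - B)) + n * B = (\<Sum>j<Suc d. h j * B ^ j)"
    if h: "h \<in> multi_indices d n" for h
  proof -
    have "(\<Sum>j=1..d. h j * (B ^ j - B)) + n * B = (\<Sum>j=1..d. h j * (B ^ j - B) + h j * B)"
      using h by (simp add: sum.distrib sum_distrib_right[symmetric] multi_indices_def)
    also have "\<dots> = (\<Sum>j=1..d. h j * B ^ j)"
    proof (intro sum.cong refl)
      fix j assume "j \<in> {1..d}"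
      then have "B \<le> B ^ j" using power_increasing[of 1 j B] B by simp
      then show "h j * (B ^ j - B) + h j * B = h j * B ^ j"
        by (simp add: distrib_left[symmetric])
    qed
    also have "\<dots> = (\<Sum>j<Suc d. h j * B ^ j)"
      by (rule sum.mono_neutral_left) (use h in \<open>auto simp: multi_indices_def\<close>)
    finally show ?thesis .
  qed
  have lt: "h j < B" if h: "h \<in> multi_indices d n" for h j
  proof (cases "j \<in> {1..d}")
    case True
    then have "h j \<le> n" using member_le_sum[of j "{1..d}" h] h by (auto simp: multi_indices_def)
    then show ?thesis using B by simp
  next
    case False
    then show ?thesis using B h by (simp add: multi_indices_def)
  qed
  have "\<mu> j = \<nu> j" if "j < Suc d" for j
    using base_expansion_unique[of "Suc d" \<mu> B \<nu> j] lt[OF \<mu>] lt[OF \<nu>] expand[OF \<mu>] expand[OF \<nu>] eq that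
    by simp
  moreover have "\<mu> j = \<nu> j" if "\<not> j < Suc d" for j
    using that \<mu> \<nu> by (simp add: multi_indices_def)
  ultimately show ?thesis by blast
qed

text \<open>
  Along the curve the polynomials vanish to pairwise different orders, so a nontrivial
  combination vanishes to the smallest order that occurs in it.
\<close>

lemma simplex_jacobi_independent:
  assumes \<kappa>: "\<And>i. i \<in> {1..d + 1} \<Longrightarrow> \<kappa> i > -1"
    and zero: "\<And>x. (\<Sum>\<mu>\<in>multi_indices d n. c \<mu> * simplex_jacobi d \<kappa> \<mu> x) = 0"
    and \<nu>: "\<nu> \<in> multi_indices d n"
  shows "c \<nu> = 0"
proof (rule ccontr)
  assume "c \<nu> \<noteq> 0"
  define B where "B = n + 2"
  define E where "E = (\<lambda>\<mu>. \<Sum>j=1..d. \<mu> j * (B ^ j - B))"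
  obtain q where q: "\<And>\<mu>. coeff (q \<mu>) 0 \<noteq> 0"
    "\<And>\<mu> t. simplex_jacobi d \<kappa> \<mu> (monomial_curve B t) = t ^ E \<mu> * poly (q \<mu>) t"
  proof -
    have "B \<ge> 2" by (simp add: B_def)
    then have "\<forall>\<mu>. \<exists>q. coeff q 0 \<noteq> 0 \<and>
        (\<forall>t. simplex_jacobi d \<kappa> \<mu> (monomial_curve B t) = t ^ E \<mu> * poly q t)"
      unfolding E_def by (intro allI simplex_jacobi_monomial_curve[OF \<kappa>])
    then show ?thesis using that by metis
  qed
  define P where "P = (\<Sum>\<mu>\<in>multi_indices d n. smult (c \<mu>) (monom 1 (E \<mu>) * q \<mu>))"
  have "poly P t = 0" for t
    using zero[of "monomial_curve B t"] by (simp add: P_def poly_sum poly_monom q(2))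
  then have "P = 0" using poly_all_0_iff_0 by blast
  define S where "S = {\<mu> \<in> multi_indices d n. c \<mu> \<noteq> 0}"
  have "finite S" "S \<noteq> {}" using finite_multi_indices \<nu> \<open>c \<nu> \<noteq> 0\<close> by (auto simp: S_def)
  then obtain \<rho> where \<rho>: "\<rho> \<in> S" "\<And>\<mu>. \<mu> \<in> S \<Longrightarrow> E \<rho> \<le> E \<mu>"
    by (metis arg_min_least arg_min_if_finite(1))
  have "coeff P (E \<rho>) = (\<Sum>\<mu>\<in>multi_indices d n. c \<mu> * coeff (monom 1 (E \<mu>) * q \<mu>) (E \<rho>))"
    by (simp add: P_def coeff_sum)
  also have "\<dots> = (\<Sum>\<mu>\<in>multi_indices d n. if \<mu> = \<rho> then c \<rho> * coeff (q \<rho>) 0 else 0)"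
  proof (intro sum.cong refl)
    fix \<mu> assume \<mu>: "\<mu> \<in> multi_indices d n"
    have "E \<rho> < E \<mu>" if "c \<mu> \<noteq> 0" "\<mu> \<noteq> \<rho>"
    proof -
      have "E \<mu> \<noteq> E \<rho>"
        using monomial_curve_order_inj[of \<mu> d n \<rho> B] \<mu> \<rho>(1) that by (auto simp: E_def B_def S_def)
      moreover have "E \<rho> \<le> E \<mu>" using \<rho>(2)[of \<mu>] \<mu> that by (simp add: S_def)
      ultimately show ?thesis by simp
    qed
    then show "c \<mu> * coeff (monom 1 (E \<mu>) * q \<mu>) (E \<rho>) = (if \<mu> = \<rho> then c \<rho> * coeff (q \<rho>) 0 else 0)"
      by (auto simp: coeff_monom_mult)
  qed
  also have "\<dots> = c \<rho> * coeff (q \<rho>) 0" using \<rho>(1) by (simp add: finite_multi_indices S_def)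
  finally show False using \<open>P = 0\<close> q(1)[of \<rho>] \<rho>(1) by (simp add: S_def)
qed

lemma conn_coeff_eqI:
  assumes \<kappa>: "\<And>i. i \<in> {1..d + 1} \<Longrightarrow> \<kappa> i > -1" and \<nu>: "\<nu> \<in> multi_indices d n"
    and supp: "\<And>\<mu>. \<mu> \<notin> multi_indices d n \<Longrightarrow> c \<mu> = 0"
    and expansion: "\<And>x. simplex_jacobi d (\<kappa> \<circ> \<tau>) \<nu> (simplex_ext d x \<circ> \<tau>) =
      (\<Sum>\<mu>\<in>multi_indices d n. c \<mu> * simplex_jacobi d \<kappa> \<mu> x)"
  shows "conn_coeff d \<tau> \<kappa> \<nu> = c"
proof -
  have n: "(\<Sum>i=1..d. \<nu> i) = n" using \<nu> by (simp add: multi_indices_def)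
  show ?thesis
    unfolding conn_coeff_def n
  proof (rule the_equality, goal_cases)
    case 1
    then show ?case using supp expansion by blast
  next
    case (2 c')
    have "c' \<mu> - c \<mu> = 0" if "\<mu> \<in> multi_indices d n" for \<mu>
      by (rule simplex_jacobi_independent[OF \<kappa> _ that])
         (use 2 expansion in \<open>auto simp: left_diff_distrib sum_subtractf\<close>)
    then show ?case using 2 supp by (intro ext) (metis right_minus_eq)
  qed
qed

section \<open>Ternary forms in the kernel of the Laplace-type operator\<close>

text \<open>
  The normalization for which \<open>x \<partial>\<^sup>2 + (\<beta> + 1) \<partial>\<close> lowers the index \<open>k\<close> by one with factor \<open>1\<close>.
\<close>

definition norm_monomial :: "real \<Rightarrow> nat \<Rightarrow> real \<Rightarrow> real" where
  "norm_monomial \<beta> k x = x ^ k / (fact k * pochhammer (\<beta> + 1) k)"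

lemma mult_norm_monomial:
  "\<beta> > -1 \<Longrightarrow> x * norm_monomial \<beta> k x =
     real (Suc k) * (\<beta> + real (Suc k)) * norm_monomial \<beta> (Suc k) x"
  using pochhammer_pos[of "\<beta> + 1" k]
  by (simp add: norm_monomial_def pochhammer_Suc divide_simps add_ac) 

text \<open>
  Normalized, all coefficients are equal up to an alternating sign: the form is
  annihilated by the sum of the operators in \<open>u\<close> and \<open>t\<close>.
\<close>

lemma jacobi_form_norm_monomial:
  assumes "\<alpha> > -1" "\<beta> > -1"
  shows "jacobi_form n \<alpha> \<beta> u t = pochhammer (\<alpha> + 1) n * pochhammer (\<beta> + 1) n *
    (\<Sum>i\<le>n. (-1) ^ i * norm_monomial \<alpha> i u * norm_monomial \<beta> (n - i) t)"
  unfolding jacobi_form_def sum_distrib_left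
proof (intro sum.cong refl)
  fix i assume "i \<in> {..n}"
  then have i: "i \<le> n" by simp
  have "pochhammer (\<alpha> + 1) n = pochhammer (\<alpha> + 1) i * pochhammer (\<alpha> + real i + 1) (n - i)"
    "pochhammer (\<beta> + 1) n = pochhammer (\<beta> + 1) (n - i) * pochhammer (\<beta> + real (n - i) + 1) i"
    using pochhammer_product[of i n "\<alpha> + 1"] pochhammer_product[of "n - i" n "\<beta> + 1"] i
    by (simp_all add: add_ac)
  moreover have "pochhammer (\<alpha> + 1) i > 0" "pochhammer (\<beta> + 1) (n - i) > 0"
    using assms by (auto intro!: pochhammer_pos)
  ultimately show "(- 1) ^ i * (pochhammer (\<alpha> + real i + 1) (n - i) / fact (n - i)) *
      (pochhammer (\<beta> + real (n - i) + 1) i / fact i) * u ^ i * t ^ (n - i) =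
    pochhammer (\<alpha> + 1) n * pochhammer (\<beta> + 1) n *
      ((-1) ^ i * norm_monomial \<alpha> i u * norm_monomial \<beta> (n - i) t)"
    unfolding norm_monomial_def by (simp add: mult_ac)
qed

text \<open>
  Coefficients, in normalized monomials, of the product of \<open>y + z\<close> to the power \<open>s\<close> with a form whose
  coefficients are \<open>(-1)\<^sup>c\<close>. For \<open>b = 0\<close> or \<open>c = 0\<close> the truncated difference is harmless, since its factor vanishes.
\<close>

fun power_coeff :: "real \<Rightarrow> real \<Rightarrow> nat \<Rightarrow> nat \<Rightarrow> nat \<Rightarrow> real" where
  "power_coeff \<beta> \<gamma> 0 b c = (-1) ^ c"
| "power_coeff \<beta> \<gamma> (Suc s) b c =
     real b * (\<beta> + real b) * power_coeff \<beta> \<gamma> s (b - 1) c +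
     real c * (\<gamma> + real c) * power_coeff \<beta> \<gamma> s b (c - 1)"

lemma power_coeff_expansion:
  assumes "\<beta> > -1" "\<gamma> > -1"
  shows "(y + z) ^ s * (\<Sum>c\<le>m. (-1) ^ c * norm_monomial \<gamma> c z * norm_monomial \<beta> (m - c) y) =
    (\<Sum>c\<le>m + s. power_coeff \<beta> \<gamma> s (m + s - c) c *
       norm_monomial \<gamma> c z * norm_monomial \<beta> (m + s - c) y)"
proof (induction s)
  case 0
  show ?case by simp
next
  case (Suc s)
  define N where "N = m + s"
  let ?M = "\<lambda>b c. norm_monomial \<gamma> c z * norm_monomial \<beta> b y"
  let ?h = "power_coeff \<beta> \<gamma> s"
  have "(y + z) ^ Suc s * (\<Sum>c\<le>m. (-1) ^ c * norm_monomial \<gamma> c z * norm_monomial \<beta> (m - c) y) =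
      (y + z) * (\<Sum>c\<le>N. ?h (N - c) c * ?M (N - c) c)"
    using Suc.IH by (simp add: N_def mult_ac)
  also have "\<dots> = (\<Sum>c\<le>N. ?h (N - c) c * norm_monomial \<gamma> c z * (y * norm_monomial \<beta> (N - c) y)) +
      (\<Sum>c\<le>N. ?h (N - c) c * norm_monomial \<beta> (N - c) y * (z * norm_monomial \<gamma> c z))"
    by (simp add: sum_distrib_left sum.distrib[symmetric] algebra_simps)
  also have "(\<Sum>c\<le>N. ?h (N - c) c * norm_monomial \<gamma> c z * (y * norm_monomial \<beta> (N - c) y)) =
      (\<Sum>c\<le>N. real (Suc N - c) * (\<beta> + real (Suc N - c)) * ?h (Suc N - c - 1) c * ?M (Suc N - c) c)"
    by (intro sum.cong refl) (simp add: mult_norm_monomial[OF assms(1)] Suc_diff_le mult_ac)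
  also have "\<dots> =
      (\<Sum>c\<le>Suc N. real (Suc N - c) * (\<beta> + real (Suc N - c)) * ?h (Suc N - c - 1) c * ?M (Suc N - c) c)"
    by simp
  also have "(\<Sum>c\<le>N. ?h (N - c) c * norm_monomial \<beta> (N - c) y * (z * norm_monomial \<gamma> c z)) =
      (\<Sum>c\<le>N. real (Suc c) * (\<gamma> + real (Suc c)) * ?h (Suc N - Suc c) (Suc c - 1) *
        ?M (Suc N - Suc c) (Suc c))"
    by (intro sum.cong refl) (simp add: mult_norm_monomial[OF assms(2)] mult_ac)
  also have "\<dots> = (\<Sum>c\<le>Suc N. real c * (\<gamma> + real c) * ?h (Suc N - c) (c - 1) * ?M (Suc N - c) c)"
    by (subst sum.atMost_Suc_shift) simp
  finally show ?case
    unfolding N_def sum.distrib[symmetric] by (simp add: distrib_right mult.assoc del: sum.atMost_Suc)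
qed

text \<open>
  The action of the operator \<open>y \<partial>\<^sub>y\<^sup>2 + (\<beta> + 1) \<partial>\<^sub>y + z \<partial>\<^sub>z\<^sup>2 + (\<gamma> + 1) \<partial>\<^sub>z\<close>
  on the product: its commutator with multiplication by \<open>y + z\<close> is \<open>2\<close> times the Euler operator plus
  the constant \<open>\<beta> + \<gamma> + 2\<close>, whence the factor
  in front of \<open>power_coeff \<beta> \<gamma> s b c\<close>.
\<close>

lemma power_coeff_rec:
  assumes "b + c = m + s"
  shows "power_coeff \<beta> \<gamma> (Suc s) (Suc b) c + power_coeff \<beta> \<gamma> (Suc s) b (Suc c) =
    real (Suc s) * (real s + 2 + \<beta> + \<gamma> + 2 * real m) * power_coeff \<beta> \<gamma> s b c"
  using assms
proof (induction s arbitrary: b c)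
  case 0
  have bc: "real m = real b + real c" using 0 by simp
  have "real c * (\<gamma> + real c) * (-1) ^ (c - 1) = - (real c * (\<gamma> + real c) * (-1) ^ c)" for c
    by (cases c) auto
  then show ?case by (cases b) (auto simp: bc algebra_simps)
next
  case (Suc s)
  let ?h = "power_coeff \<beta> \<gamma>" and ?l = "\<lambda>s. real (Suc s) * (real s + 2 + \<beta> + \<gamma> + 2 * real m)"
  have b: "real b * (\<beta> + real b) * (?h (Suc s) b c + ?h (Suc s) (b - 1) (Suc c)) =
      real b * (\<beta> + real b) * (?l s * ?h s (b - 1) c)"
    using Suc.IH[of "b - 1" c] Suc.prems by (cases b) auto
  have c: "real c * (\<gamma> + real c) * (?h (Suc s) (Suc b) (c - 1) + ?h (Suc s) b c) =
      real c * (\<gamma> + real c) * (?l s * ?h s b (c - 1))"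
    using Suc.IH[of b "c - 1"] Suc.prems by (cases c) auto
  have m: "real b + real c = real m + real s + 1"
    using Suc.prems by linarith
  have "?h (Suc (Suc s)) (Suc b) c + ?h (Suc (Suc s)) b (Suc c) =
      real (Suc b) * (\<beta> + real (Suc b)) * ?h (Suc s) b c +
      real c * (\<gamma> + real c) * ?h (Suc s) (Suc b) (c - 1) +
      (real b * (\<beta> + real b) * ?h (Suc s) (b - 1) (Suc c) +
      real (Suc c) * (\<gamma> + real (Suc c)) * ?h (Suc s) b c)"
    by (simp only: power_coeff.simps(2)[of \<beta> \<gamma> "Suc s"] diff_Suc_1)
  also have "\<dots> = (2 * (real b + real c) + 2 + \<beta> + \<gamma>) * ?h (Suc s) b c +
      ?l s * (real b * (\<beta> + real b) * ?h s (b - 1) c + real c * (\<gamma> + real c) * ?h s b (c - 1))"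
    using b c by (simp add: algebra_simps del: power_coeff.simps)
  also have "\<dots> = ?l (Suc s) * ?h (Suc s) b c"
    unfolding m power_coeff.simps(2)[of \<beta> \<gamma> s b c, symmetric] by (simp add: algebra_simps del: power_coeff.simps)
  finally show ?case .
qed

lemma power_coeff_face:
  "s \<le> b \<Longrightarrow> power_coeff \<beta> \<gamma> s b 0 = fact b / fact (b - s) * pochhammer (\<beta> + real (b - s) + 1) s"
proof (induction s arbitrary: b)
  case (Suc s)
  then obtain b' where b: "b = Suc b'" by (cases b) auto
  show ?case using Suc.IH[of b'] Suc.prems
    by (simp add: b pochhammer_Suc of_nat_diff field_simps)
qed simp


text \<open>
  The two-variable polynomial with index \<open>(n - m, m)\<close>, as a form of degree \<open>n\<close> in the three barycentric
  coordinates.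
\<close>

definition ternary_form ::
    "nat \<Rightarrow> nat \<Rightarrow> real \<Rightarrow> real \<Rightarrow> real \<Rightarrow> real \<Rightarrow> real \<Rightarrow> real \<Rightarrow> real" where
  "ternary_form n m \<kappa>\<^sub>1 \<kappa>\<^sub>2 \<kappa>\<^sub>3 x y z =
     jacobi_form (n - m) (\<kappa>\<^sub>2 + \<kappa>\<^sub>3 + 2 * real m + 1) \<kappa>\<^sub>1 (y + z) x * jacobi_form m \<kappa>\<^sub>3 \<kappa>\<^sub>2 z y"

definition ternary_coeff ::
    "nat \<Rightarrow> nat \<Rightarrow> real \<Rightarrow> real \<Rightarrow> real \<Rightarrow> nat \<Rightarrow> nat \<Rightarrow> nat \<Rightarrow> real" where
  "ternary_coeff n m \<kappa>\<^sub>1 \<kappa>\<^sub>2 \<kappa>\<^sub>3 a b c = (if m + a \<le> n then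
     pochhammer (\<kappa>\<^sub>2 + \<kappa>\<^sub>3 + 2 * real m + 2) (n - m) * pochhammer (\<kappa>\<^sub>1 + 1) (n - m) *
     pochhammer (\<kappa>\<^sub>2 + 1) m * pochhammer (\<kappa>\<^sub>3 + 1) m *
     ((-1) ^ (n - m - a) /
       (fact (n - m - a) * pochhammer (\<kappa>\<^sub>2 + \<kappa>\<^sub>3 + 2 * real m + 2) (n - m - a))) *
     power_coeff \<kappa>\<^sub>2 \<kappa>\<^sub>3 (n - m - a) b c else 0)"

lemma ternary_form_expansion:
  assumes \<kappa>: "\<kappa>\<^sub>1 > -1" "\<kappa>\<^sub>2 > -1" "\<kappa>\<^sub>3 > -1" and m: "m \<le> n"
  shows "ternary_form n m \<kappa>\<^sub>1 \<kappa>\<^sub>2 \<kappa>\<^sub>3 x y z =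
    (\<Sum>a\<le>n. \<Sum>c\<le>n - a. ternary_coeff n m \<kappa>\<^sub>1 \<kappa>\<^sub>2 \<kappa>\<^sub>3 a (n - a - c) c *
       (norm_monomial \<kappa>\<^sub>1 a x * norm_monomial \<kappa>\<^sub>2 (n - a - c) y * norm_monomial \<kappa>\<^sub>3 c z))"
proof -
  define \<alpha> where "\<alpha> = \<kappa>\<^sub>2 + \<kappa>\<^sub>3 + 2 * real m + 1"
  have \<alpha>: "\<alpha> > -1" using \<kappa> by (simp add: \<alpha>_def)
  let ?C = "pochhammer (\<alpha> + 1) (n - m) * pochhammer (\<kappa>\<^sub>1 + 1) (n - m) *
     pochhammer (\<kappa>\<^sub>2 + 1) m * pochhammer (\<kappa>\<^sub>3 + 1) m"
  let ?Q = "\<Sum>c\<le>m. (-1) ^ c * norm_monomial \<kappa>\<^sub>3 c z * norm_monomial \<kappa>\<^sub>2 (m - c) y"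
  let ?s = "\<lambda>a. n - m - a"
  have "ternary_form n m \<kappa>\<^sub>1 \<kappa>\<^sub>2 \<kappa>\<^sub>3 x y z =
      (\<Sum>s\<le>n - m. ?C * ((-1) ^ s / (fact s * pochhammer (\<alpha> + 1) s)) *
        norm_monomial \<kappa>\<^sub>1 (n - m - s) x * ((y + z) ^ s * ?Q))"
    unfolding ternary_form_def \<alpha>_def[symmetric] jacobi_form_norm_monomial[OF \<alpha> \<kappa>(1)]
      jacobi_form_norm_monomial[OF \<kappa>(3,2)] norm_monomial_def[of \<alpha>]
    by (simp add: sum_distrib_left sum_distrib_right mult_ac)
  also have "\<dots> = (\<Sum>a\<le>n - m. ?C * ((-1) ^ ?s a / (fact (?s a) * pochhammer (\<alpha> + 1) (?s a))) *
        norm_monomial \<kappa>\<^sub>1 a x * ((y + z) ^ ?s a * ?Q))"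
    by (rule sum.reindex_bij_witness[of _ "\<lambda>s. n - m - s" "\<lambda>s. n - m - s"])
       (auto simp del: diff_diff_left)
  also have "\<dots> = (\<Sum>a\<le>n - m. \<Sum>c\<le>n - a. ternary_coeff n m \<kappa>\<^sub>1 \<kappa>\<^sub>2 \<kappa>\<^sub>3 a (n - a - c) c *
       (norm_monomial \<kappa>\<^sub>1 a x * norm_monomial \<kappa>\<^sub>2 (n - a - c) y * norm_monomial \<kappa>\<^sub>3 c z))"
  proof (intro sum.cong refl)
    fix a assume "a \<in> {..n - m}"
    then have a: "m + a \<le> n" "m + (n - m - a) = n - a" using m by auto
    have \<alpha>1: "\<alpha> + 1 = \<kappa>\<^sub>2 + \<kappa>\<^sub>3 + 2 * real m + 2" by (simp add: \<alpha>_def)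
    show "?C * ((-1) ^ ?s a / (fact (?s a) * pochhammer (\<alpha> + 1) (?s a))) *
        norm_monomial \<kappa>\<^sub>1 a x * ((y + z) ^ ?s a * ?Q) =
      (\<Sum>c\<le>n - a. ternary_coeff n m \<kappa>\<^sub>1 \<kappa>\<^sub>2 \<kappa>\<^sub>3 a (n - a - c) c *
       (norm_monomial \<kappa>\<^sub>1 a x * norm_monomial \<kappa>\<^sub>2 (n - a - c) y * norm_monomial \<kappa>\<^sub>3 c z))"
      unfolding power_coeff_expansion[OF \<kappa>(2,3)] a(2)
      unfolding sum_distrib_left
      by (intro sum.cong refl) (simp add: ternary_coeff_def a(1) \<alpha>1 mult_ac)
  qed
  also have "\<dots> = (\<Sum>a\<le>n. \<Sum>c\<le>n - a. ternary_coeff n m \<kappa>\<^sub>1 \<kappa>\<^sub>2 \<kappa>\<^sub>3 a (n - a - c) c *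
       (norm_monomial \<kappa>\<^sub>1 a x * norm_monomial \<kappa>\<^sub>2 (n - a - c) y * norm_monomial \<kappa>\<^sub>3 c z))"
  proof (rule sum.mono_neutral_left)
    have "ternary_coeff n m \<kappa>\<^sub>1 \<kappa>\<^sub>2 \<kappa>\<^sub>3 a b c = 0" if "a \<in> {..n} - {..n - m}" for a b c
    proof -
      have "\<not> m + a \<le> n" using that m by auto
      then show ?thesis by (simp add: ternary_coeff_def)
    qed
    then show "\<forall>a\<in>{..n} - {..n - m}. (\<Sum>c\<le>n - a. ternary_coeff n m \<kappa>\<^sub>1 \<kappa>\<^sub>2 \<kappa>\<^sub>3 a (n - a - c) c *
       (norm_monomial \<kappa>\<^sub>1 a x * norm_monomial \<kappa>\<^sub>2 (n - a - c) y * norm_monomial \<kappa>\<^sub>3 c z)) = 0"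
      by simp
  qed auto
  finally show ?thesis .
qed

text \<open>
  The kernel of \<open>\<Sum>\<^sub>i x\<^sub>i \<partial>\<^sub>i\<^sup>2 + (\<kappa>\<^sub>i + 1) \<partial>\<^sub>i\<close> in terms of the coefficients with respect to
  normalized monomials. The parameters have been absorbed by the normalization.
\<close>

definition laplace_coeffs :: "nat \<Rightarrow> (nat \<Rightarrow> nat \<Rightarrow> nat \<Rightarrow> real) \<Rightarrow> bool" where
  "laplace_coeffs n g \<longleftrightarrow>
     (\<forall>a b c. a + b + c + 1 = n \<longrightarrow> g (Suc a) b c + g a (Suc b) c + g a b (Suc c) = 0)"

text \<open>
  The part of the operator in the last two variables lowers the power of \<open>y + z\<close> by one,
  and the part in the first variable lowers the power of \<open>x\<close>. The alternating coefficients of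
  the first Jacobi form, whose parameter is \<open>\<kappa>\<^sub>2 + \<kappa>\<^sub>3 + 2m + 1\<close>, make the two contributions cancel.
\<close>

lemma laplace_coeffs_ternary_coeff:
  assumes \<kappa>: "\<kappa>\<^sub>2 > -1" "\<kappa>\<^sub>3 > -1"
  shows "laplace_coeffs n (ternary_coeff n m \<kappa>\<^sub>1 \<kappa>\<^sub>2 \<kappa>\<^sub>3)"
  unfolding laplace_coeffs_def
proof (intro allI impI)
  fix a b c assume abc: "a + b + c + 1 = n"
  define A where "A = \<kappa>\<^sub>2 + \<kappa>\<^sub>3 + 2 * real m + 2"
  consider "m + a > n" | "m + a = n" | s where "n - m - a = Suc s" "m + a < n"
    by (metis Suc_diff_Suc diff_diff_left linorder_cases less_or_eq_imp_le zero_less_diff gr0_implies_Suc)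
  then show "ternary_coeff n m \<kappa>\<^sub>1 \<kappa>\<^sub>2 \<kappa>\<^sub>3 (Suc a) b c + ternary_coeff n m \<kappa>\<^sub>1 \<kappa>\<^sub>2 \<kappa>\<^sub>3 a (Suc b) c +
      ternary_coeff n m \<kappa>\<^sub>1 \<kappa>\<^sub>2 \<kappa>\<^sub>3 a b (Suc c) = 0"
  proof cases
    case 1
    then show ?thesis by (simp add: ternary_coeff_def)
  next
    case 2
    then have "n - m - a = 0" by simp
    with 2 show ?thesis by (simp add: ternary_coeff_def)
  next
    case (3 s)
    then have s: "n - m - Suc a = s" "m + Suc a \<le> n" "m + a \<le> n" "b + c = m + s"
      using abc by auto
    let ?P = "pochhammer A s"
    have pos: "?P > 0" "A + real s > 0"
      using \<kappa> by (auto simp: A_def intro!: pochhammer_pos)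
    have rec: "power_coeff \<kappa>\<^sub>2 \<kappa>\<^sub>3 (Suc s) (Suc b) c + power_coeff \<kappa>\<^sub>2 \<kappa>\<^sub>3 (Suc s) b (Suc c) =
        real (Suc s) * (A + real s) * power_coeff \<kappa>\<^sub>2 \<kappa>\<^sub>3 s b c"
      unfolding power_coeff_rec[OF s(4)] by (simp add: A_def algebra_simps)
    define K where "K = pochhammer A (n - m) * pochhammer (\<kappa>\<^sub>1 + 1) (n - m) *
     pochhammer (\<kappa>\<^sub>2 + 1) m * pochhammer (\<kappa>\<^sub>3 + 1) m"
    have "ternary_coeff n m \<kappa>\<^sub>1 \<kappa>\<^sub>2 \<kappa>\<^sub>3 a (Suc b) c + ternary_coeff n m \<kappa>\<^sub>1 \<kappa>\<^sub>2 \<kappa>\<^sub>3 a b (Suc c) =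
        K * ((-1) ^ Suc s / (fact (Suc s) * pochhammer A (Suc s))) *
        (power_coeff \<kappa>\<^sub>2 \<kappa>\<^sub>3 (Suc s) (Suc b) c + power_coeff \<kappa>\<^sub>2 \<kappa>\<^sub>3 (Suc s) b (Suc c))"
      using s(3) unfolding ternary_coeff_def 3(1) A_def[symmetric] K_def[symmetric]
      by (simp add: distrib_left del: power_coeff.simps fact_Suc)
    also have "\<dots> = - (K * ((-1) ^ s / (fact s * ?P)) * power_coeff \<kappa>\<^sub>2 \<kappa>\<^sub>3 s b c)"
      unfolding rec using pos by (simp add: pochhammer_Suc divide_simps del: of_nat_Suc)
    also have "\<dots> = - ternary_coeff n m \<kappa>\<^sub>1 \<kappa>\<^sub>2 \<kappa>\<^sub>3 (Suc a) b c"
      using s(2) unfolding ternary_coeff_def s(1) A_def[symmetric] K_def[symmetric] by simp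
    finally show ?thesis by simp
  qed
qed

text \<open>
  The relation expresses the coefficients with last index \<open>c + 1\<close> by those with last index \<open>c\<close>.
\<close>

lemma laplace_coeffs_face_eqI:
  assumes f: "laplace_coeffs n f" and g: "laplace_coeffs n g"
    and face: "\<And>a b. a + b = n \<Longrightarrow> f a b 0 = g a b 0"
    and "a + b + c = n"
  shows "f a b c = g a b c"
  using assms(4)
proof (induction c arbitrary: a b)
  case 0
  then show ?case using face by simp
next
  case (Suc c)
  have "h a b (Suc c) = - h (Suc a) b c - h a (Suc b) c" if "laplace_coeffs n h" for h
  proof -
    have "h (Suc a) b c + h a (Suc b) c + h a b (Suc c) = 0"
      using that Suc.prems by (simp add: laplace_coeffs_def)
    then show ?thesis by linarith
  qed
  from this[OF f] this[OF g] show ?case using Suc by simp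
qed

lemma ternary_coeff_face:
  assumes \<kappa>: "\<kappa>\<^sub>2 > -1" "\<kappa>\<^sub>3 > -1" and ab: "a + b = n"
  shows "ternary_coeff n m \<kappa>\<^sub>1 \<kappa>\<^sub>2 \<kappa>\<^sub>3 a b 0 = (-1) ^ (b - m) * real (b choose m) *
    pochhammer (\<kappa>\<^sub>1 + 1) (n - m) * pochhammer (\<kappa>\<^sub>2 + 1) b * pochhammer (\<kappa>\<^sub>3 + 1) m *
    pochhammer (\<kappa>\<^sub>2 + \<kappa>\<^sub>3 + real m + real b + 2) a"
proof (cases "m \<le> b")
  case True
  then have *: "m + a \<le> n" "n - m - a = b - m" "b - (b - m) = m" "b - m + a = n - m"
    using ab by auto
  define A where "A = \<kappa>\<^sub>2 + \<kappa>\<^sub>3 + 2 * real m + 2"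
  have "pochhammer (\<kappa>\<^sub>2 + 1) b = pochhammer (\<kappa>\<^sub>2 + 1) m * pochhammer (\<kappa>\<^sub>2 + real m + 1) (b - m)"
    using pochhammer_product[OF True, of "\<kappa>\<^sub>2 + 1"] by (simp add: add_ac)
  moreover have "pochhammer A (n - m) =
      pochhammer A (b - m) * pochhammer (\<kappa>\<^sub>2 + \<kappa>\<^sub>3 + real m + real b + 2) a"
    using pochhammer_product'[of A "b - m" a, unfolded *(4)] True
    by (simp add: A_def of_nat_diff algebra_simps)
  moreover have "pochhammer A (b - m) > 0"
    using \<kappa> by (auto simp: A_def intro!: pochhammer_pos)
  ultimately show ?thesis
    using *(1) True unfolding ternary_coeff_def *(2) A_def[symmetric]
    by (simp add: power_coeff_face *(3) binomial_fact mult_ac)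
next
  case False
  then show ?thesis using ab by (simp add: ternary_coeff_def binomial_eq_0)
qed

section \<open>Exchanging two variables\<close>

lemma pochhammer_minus_nat_fact:
  "k \<le> m \<Longrightarrow> pochhammer (- real m) k = (-1) ^ k * (fact m / fact (m - k))"
  by (simp add: pochhammer_minus pochhammer_fact pochhammer_product[of "m - k" m "1 :: real"] of_nat_diff)
     (simp add: pochhammer_fact[symmetric] add_ac)

text \<open>
  The numerator \<open>(-m)\<^sub>k (m + a)\<^sub>k\<close>, as a function of \<open>m\<close>, is the product of \<open>m (m + a) - i (i + a)\<close> over \<open>i < k\<close>
  up to sign. It removes the first \<open>k\<close> nodes and leaves the weights for the others.
\<close>

lemma wp_weight_shift:
  assumes a: "a > -1" and km: "k + i \<le> b"
  shows "wp_weight b a (k + i) * (pochhammer (- real (k + i)) k * pochhammer (a + real (k + i)) k) =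
    fact b / fact (b - k) * wp_weight (b - k) (a + 2 * real k) i"
proof -
  define X Y Z where "X = pochhammer (a + real (k + i)) k"
    and "Y = pochhammer (a + 2 * real k + real i) i"
    and "Z = pochhammer (a + 2 * real k + 2 * real i + 1) (b - k - i)"
  have X: "X > 0"
    using a by (cases "k = 0") (auto simp: X_def intro!: pochhammer_pos)
  have XY: "pochhammer (a + real (k + i)) (k + i) = X * Y"
    using pochhammer_product'[of "a + real (k + i)" k i] by (simp add: X_def Y_def algebra_simps)
  have Z: "pochhammer (a + 2 * real (k + i) + 1) (b - (k + i)) = Z"
    by (simp add: Z_def algebra_simps)
  have binom: "real (b choose (k + i)) * (fact (k + i) / fact i) =
      fact b / fact (b - k) * real ((b - k) choose i)"
    using km by (simp add: binomial_fact)
  have "wp_weight b a (k + i) * (pochhammer (- real (k + i)) k * X) =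
      ((-1) ^ (k + i) * (-1) ^ k) * (real (b choose (k + i)) * (fact (k + i) / fact i)) / (Y * Z)"
    unfolding wp_weight_def XY Z using X by (subst pochhammer_minus_nat_fact) (auto simp: mult_ac)
  also have "(-1) ^ (k + i) * (-1) ^ k = ((-1) ^ i :: real)"
    by (simp add: power_add power_mult_distrib[symmetric])
  also have "(-1) ^ i * (real (b choose (k + i)) * (fact (k + i) / fact i)) / (Y * Z) =
      fact b / fact (b - k) * wp_weight (b - k) (a + 2 * real k) i"
    unfolding binom wp_weight_def Y_def Z_def by (simp add: mult_ac)
  finally show ?thesis unfolding X_def .
qed

lemma pochhammer_reflect:
  fixes x :: real
  assumes "i \<le> n"
  shows "(-1) ^ i * pochhammer (x + 1) (n - i) * pochhammer (- real n - x) i = pochhammer (x + 1) n"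
proof -
  have "pochhammer (- real n - x) i = (-1) ^ i * pochhammer (x + 1 + real (n - i)) i"
  proof -
    have "- real n - x = - (real n + x)" by simp
    then show ?thesis
      using assms by (simp only: pochhammer_minus) (simp add: of_nat_diff algebra_simps)
  qed
  then show ?thesis
    using pochhammer_product[of "n - i" n "x + 1"] assms by (simp add: power_mult_distrib[symmetric])
qed

text \<open>
  The sum over the basis index \<open>m\<close> for a fixed index \<open>k\<close> of the \<open>4F3\<close>. Only \<open>m \<ge> k\<close> contributes, and after
  the shift \<open>m = k + i\<close> it is the \<open>5F4\<close> summation with \<open>a = \<kappa>\<^sub>2 + \<kappa>\<^sub>3 + 1 + 2k\<close>,
  \<open>b = \<kappa>\<^sub>3 + 1 + k\<close> and \<open>c = \<rho> + k\<close>. The factor \<open>(\<kappa>\<^sub>1 + 1)\<^sub>n\<^sub>-\<^sub>m\<close>, read backwards, is the denominator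
  parameter \<open>1 + a - c\<close>.
\<close>

lemma wp_weight_sum:
  fixes \<kappa>\<^sub>1 \<kappa>\<^sub>2 \<kappa>\<^sub>3 :: real
  assumes \<kappa>: "\<kappa>\<^sub>1 > -1" "\<kappa>\<^sub>2 > -1" "\<kappa>\<^sub>3 > -1" and kb: "k \<le> b" and n: "a + b = n"
    and \<rho>: "\<rho> = real n + (\<kappa>\<^sub>1 + \<kappa>\<^sub>2 + \<kappa>\<^sub>3) + 2" and a\<^sub>0: "a\<^sub>0 = \<kappa>\<^sub>2 + \<kappa>\<^sub>3 + 1"
  shows "(\<Sum>m\<le>b. wp_weight b a\<^sub>0 m * (-1) ^ m * pochhammer (\<kappa>\<^sub>1 + 1) (n - m) *
      (pochhammer (\<kappa>\<^sub>3 + 1) m * pochhammer \<rho> m / pochhammer (\<kappa>\<^sub>2 + 1) m) *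
      (pochhammer (- real m) k * pochhammer (a\<^sub>0 + real m) k /
        (pochhammer (\<kappa>\<^sub>3 + 1) k * pochhammer \<rho> k))) =
    (-1) ^ k * (fact b / fact (b - k)) * pochhammer (\<kappa>\<^sub>1 + 1) a *
      pochhammer (\<kappa>\<^sub>1 + \<kappa>\<^sub>3 + real a + 2 + real k) (b - k) / pochhammer (\<kappa>\<^sub>2 + 1) b"
    (is "(\<Sum>m\<le>b. ?t m) = _")
proof -
  define N where "N = b - k"
  define \<alpha> \<beta> \<gamma> where "\<alpha> = a\<^sub>0 + 2 * real k" and "\<beta> = \<kappa>\<^sub>3 + 1 + real k" and "\<gamma> = \<rho> + real k"
  have kn: "k \<le> n" "N \<le> n - k" "n - k - N = a" using kb n by (auto simp: N_def)
  have params: "1 + \<alpha> - \<beta> = \<kappa>\<^sub>2 + 1 + real k" "1 + \<alpha> - \<gamma> = - real (n - k) - \<kappa>\<^sub>1"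
    "1 + \<alpha> - \<beta> - \<gamma> = - (real n + \<kappa>\<^sub>1 + \<kappa>\<^sub>3 + 1)"
    using kn(1) by (simp_all add: \<alpha>_def \<beta>_def \<gamma>_def a\<^sub>0 \<rho> of_nat_diff)
  have pos1: "pochhammer (x + 1) j > 0" if "x > -1" for x :: real and j
    using that by (intro pochhammer_pos) simp
  have pos2: "k = 0 \<or> pochhammer \<rho> k > 0"
    using \<kappa> kn(1) by (cases "k = 0") (auto simp: \<rho> intro!: pochhammer_pos)
  then have rho_nz: "pochhammer \<rho> k \<noteq> 0" by auto
  have reflect: "(-1) ^ i * pochhammer (\<kappa>\<^sub>1 + 1) (n - k - i) = pochhammer (\<kappa>\<^sub>1 + 1) (n - k) /
      pochhammer (1 + \<alpha> - \<gamma>) i" and reflect_nz: "pochhammer (1 + \<alpha> - \<gamma>) i \<noteq> 0" if "i \<le> N" for i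
  proof -
    have *: "(-1) ^ i * pochhammer (\<kappa>\<^sub>1 + 1) (n - k - i) * pochhammer (1 + \<alpha> - \<gamma>) i =
        pochhammer (\<kappa>\<^sub>1 + 1) (n - k)"
      unfolding params by (rule pochhammer_reflect) (use that kn in auto)
    with pos1[OF \<kappa>(1), of "n - k"] show "pochhammer (1 + \<alpha> - \<gamma>) i \<noteq> 0" by auto
    with * show "(-1) ^ i * pochhammer (\<kappa>\<^sub>1 + 1) (n - k - i) = pochhammer (\<kappa>\<^sub>1 + 1) (n - k) /
      pochhammer (1 + \<alpha> - \<gamma>) i" by (simp add: field_simps)
  qed
  have "(\<Sum>m\<le>b. ?t m) = (\<Sum>m\<in>{k..b}. ?t m)"
    by (rule sum.mono_neutral_right) (auto simp: pochhammer_of_nat_eq_0_lemma)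
  also have "\<dots> = (\<Sum>i\<le>N. ?t (k + i))"
    by (rule sum.reindex_bij_witness[of _ "\<lambda>i. k + i" "\<lambda>m. m - k"]) (use kb in \<open>auto simp: N_def\<close>)
  also have "\<dots> = (\<Sum>i\<le>N. fact b / fact N * ((-1) ^ k * pochhammer (\<kappa>\<^sub>1 + 1) (n - k)) /
      pochhammer (\<kappa>\<^sub>2 + 1) k * (wp_weight N \<alpha> i *
      (pochhammer \<beta> i * pochhammer \<gamma> i / (pochhammer (1 + \<alpha> - \<beta>) i * pochhammer (1 + \<alpha> - \<gamma>) i))))"
  proof (intro sum.cong refl)
    fix i assume "i \<in> {..N}"
    then have i: "i \<le> N" "k + i \<le> b" using kb by (auto simp: N_def)
    have split: "pochhammer (\<kappa>\<^sub>3 + 1) (k + i) = pochhammer (\<kappa>\<^sub>3 + 1) k * pochhammer \<beta> i"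
      "pochhammer \<rho> (k + i) = pochhammer \<rho> k * pochhammer \<gamma> i"
      "pochhammer (\<kappa>\<^sub>2 + 1) (k + i) = pochhammer (\<kappa>\<^sub>2 + 1) k * pochhammer (1 + \<alpha> - \<beta>) i"
      unfolding params by (simp_all add: pochhammer_product' \<beta>_def \<gamma>_def)
    have w: "wp_weight b a\<^sub>0 (k + i) * (pochhammer (- real (k + i)) k * pochhammer (a\<^sub>0 + real (k + i)) k) =
        fact b / fact N * wp_weight N \<alpha> i"
      unfolding N_def \<alpha>_def by (rule wp_weight_shift) (use \<kappa> i in \<open>auto simp: a\<^sub>0\<close>)
    have "?t (k + i) = (wp_weight b a\<^sub>0 (k + i) *
        (pochhammer (- real (k + i)) k * pochhammer (a\<^sub>0 + real (k + i)) k)) *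
        ((-1) ^ k * ((-1) ^ i * pochhammer (\<kappa>\<^sub>1 + 1) (n - k - i))) *
        (pochhammer (\<kappa>\<^sub>3 + 1) (k + i) * pochhammer \<rho> (k + i) / pochhammer (\<kappa>\<^sub>2 + 1) (k + i)) /
        (pochhammer (\<kappa>\<^sub>3 + 1) k * pochhammer \<rho> k)"
      by (simp add: power_add mult_ac)
    also have "\<dots> = (fact b / fact N * wp_weight N \<alpha> i) *
        ((-1) ^ k * (pochhammer (\<kappa>\<^sub>1 + 1) (n - k) / pochhammer (1 + \<alpha> - \<gamma>) i)) *
        (pochhammer \<beta> i * pochhammer \<gamma> i / (pochhammer (\<kappa>\<^sub>2 + 1) k * pochhammer (1 + \<alpha> - \<beta>) i))"
      unfolding w reflect[OF i(1)] split using pos1[OF \<kappa>(3), of k] rho_nz by simp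
    finally show "?t (k + i) = fact b / fact N * ((-1) ^ k * pochhammer (\<kappa>\<^sub>1 + 1) (n - k)) /
      pochhammer (\<kappa>\<^sub>2 + 1) k * (wp_weight N \<alpha> i *
      (pochhammer \<beta> i * pochhammer \<gamma> i / (pochhammer (1 + \<alpha> - \<beta>) i * pochhammer (1 + \<alpha> - \<gamma>) i)))"
      by (simp add: mult_ac)
  qed
  also have "\<dots> = fact b / fact N * ((-1) ^ k * pochhammer (\<kappa>\<^sub>1 + 1) (n - k)) /
      pochhammer (\<kappa>\<^sub>2 + 1) k * (pochhammer (1 + \<alpha> - \<beta> - \<gamma>) N /
      (pochhammer (1 + \<alpha> - \<beta>) N * pochhammer (1 + \<alpha> - \<gamma>) N))"
  proof -
    have "pochhammer (1 + \<alpha> - \<beta>) N > 0" unfolding params using \<kappa> by (intro pochhammer_pos) simp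
    then have "pochhammer (1 + \<alpha> - \<beta>) N \<noteq> 0" by simp
    moreover have "\<alpha> > -1" using \<kappa> by (simp add: \<alpha>_def a\<^sub>0)
    ultimately show ?thesis
      unfolding sum_distrib_left[symmetric] using reflect_nz[of N] by (subst dougall_5F4) auto
  qed
  also have "\<dots> = (-1) ^ k * (fact b / fact N) * ((-1) ^ N * pochhammer (\<kappa>\<^sub>1 + 1) (n - k - N)) *
      pochhammer (1 + \<alpha> - \<beta> - \<gamma>) N / (pochhammer (\<kappa>\<^sub>2 + 1) k * pochhammer (\<kappa>\<^sub>2 + 1 + real k) N)"
    unfolding reflect[OF order.refl] params(1) by (simp add: mult_ac)
  also have "pochhammer (\<kappa>\<^sub>2 + 1) k * pochhammer (\<kappa>\<^sub>2 + 1 + real k) N = pochhammer (\<kappa>\<^sub>2 + 1) b"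
    unfolding N_def by (rule pochhammer_product[OF kb, symmetric])
  also have "pochhammer (1 + \<alpha> - \<beta> - \<gamma>) N =
      (-1) ^ N * pochhammer (\<kappa>\<^sub>1 + \<kappa>\<^sub>3 + real a + 2 + real k) N"
    unfolding params(3) pochhammer_minus using kb n
    by (simp add: N_def of_nat_diff algebra_simps flip: n)
  also have "(-1) ^ k * (fact b / fact N) * ((-1) ^ N * pochhammer (\<kappa>\<^sub>1 + 1) (n - k - N)) *
        ((-1) ^ N * pochhammer (\<kappa>\<^sub>1 + \<kappa>\<^sub>3 + real a + 2 + real k) N) / pochhammer (\<kappa>\<^sub>2 + 1) b =
      (-1) ^ k * (fact b / fact N) * pochhammer (\<kappa>\<^sub>1 + 1) a *
        pochhammer (\<kappa>\<^sub>1 + \<kappa>\<^sub>3 + real a + 2 + real k) N / pochhammer (\<kappa>\<^sub>2 + 1) b"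
    unfolding kn(3) by (simp add: mult_ac)
  finally show ?thesis unfolding N_def .
qed

text \<open>
  What remains of the \<open>4F3\<close> after the sum over \<open>m\<close>. The numerator parameters \<open>-j\<close> and
  \<open>j + \<kappa>\<^sub>1 + \<kappa>\<^sub>3 + 1\<close> add up to \<open>\<kappa>\<^sub>1 + \<kappa>\<^sub>3 + 1\<close>, so Saalschuetz's formula with third parameter
  \<open>\<kappa>\<^sub>1 + \<kappa>\<^sub>3 + a + 2\<close> contains \<open>(a + 1)\<^sub>b\<^sub>-\<^sub>k\<close>, which cancels against \<open>(-n)\<^sub>k\<close> because \<open>a + b = n\<close>.
\<close>

lemma saalschutz_sum:
  fixes \<kappa>\<^sub>1 \<kappa>\<^sub>3 :: real
  assumes n: "a + b = n" and j: "j \<le> n"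
  shows "(\<Sum>k\<le>b. (-1) ^ k * (fact b / fact (b - k)) *
      pochhammer (\<kappa>\<^sub>1 + \<kappa>\<^sub>3 + real a + 2 + real k) (b - k) *
      (pochhammer (- real j) k * pochhammer (real j + \<kappa>\<^sub>1 + \<kappa>\<^sub>3 + 1) k /
        (pochhammer (- real n) k * fact k))) =
    (if j \<le> a then fact a * fact (n - j) / (fact n * fact (a - j)) *
       pochhammer (\<kappa>\<^sub>1 + \<kappa>\<^sub>3 + real j + real a + 2) b else 0)"
proof -
  define c where "c = \<kappa>\<^sub>1 + \<kappa>\<^sub>3 + real a + 2"
  have d: "c - (- real j) - (real j + \<kappa>\<^sub>1 + \<kappa>\<^sub>3 + 1) = real a + 1" by (simp add: c_def)
  have "(\<Sum>k\<le>b. (-1) ^ k * (fact b / fact (b - k)) * pochhammer (c + real k) (b - k) *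
      (pochhammer (- real j) k * pochhammer (real j + \<kappa>\<^sub>1 + \<kappa>\<^sub>3 + 1) k /
        (pochhammer (- real n) k * fact k))) =
    (\<Sum>k\<le>b. fact a / fact n * (real (b choose k) * pochhammer (- real j) k *
      pochhammer (real j + \<kappa>\<^sub>1 + \<kappa>\<^sub>3 + 1) k * pochhammer (c + real k) (b - k) *
      pochhammer (real a + 1) (b - k)))"
  proof (intro sum.cong refl)
    fix k assume "k \<in> {..b}"
    then have k: "k \<le> b" "k \<le> n" "a + (b - k) = n - k" using n by auto
    have "fact (n - k) = fact a * pochhammer (real a + 1) (b - k)"
      unfolding pochhammer_fact k(3)[symmetric] pochhammer_product' by (simp add: add_ac)
    then have "pochhammer (real a + 1) (b - k) = fact (n - k) / fact a" by simp
    then show "(-1) ^ k * (fact b / fact (b - k)) * pochhammer (c + real k) (b - k) *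
      (pochhammer (- real j) k * pochhammer (real j + \<kappa>\<^sub>1 + \<kappa>\<^sub>3 + 1) k /
        (pochhammer (- real n) k * fact k)) =
      fact a / fact n * (real (b choose k) * pochhammer (- real j) k *
      pochhammer (real j + \<kappa>\<^sub>1 + \<kappa>\<^sub>3 + 1) k * pochhammer (c + real k) (b - k) *
      pochhammer (real a + 1) (b - k))"
      using k by (simp add: pochhammer_minus_nat_fact[OF k(2)] binomial_fact[OF k(1)] field_simps)
  qed
  also have "\<dots> = fact a / fact n * (pochhammer (c + real j) b * pochhammer (real a + 1 - real j) b)"
    using saalschutz[of b "- real j" "real j + \<kappa>\<^sub>1 + \<kappa>\<^sub>3 + 1" c]
    unfolding d sum_distrib_left[symmetric] by (simp add: c_def algebra_simps)
  also have "pochhammer (real a + 1 - real j) b = (if j \<le> a then fact (n - j) / fact (a - j) else 0)"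
  proof (cases "j \<le> a")
    case True
    then have "a - j + b = n - j" using n by auto
    from True have "fact (n - j) = fact (a - j) * pochhammer (real a + 1 - real j) b"
      unfolding pochhammer_fact \<open>a - j + b = n - j\<close>[symmetric] pochhammer_product'
      by (simp add: of_nat_diff algebra_simps)
    then show ?thesis using True by simp
  next
    case False
    then have shift: "real a + 1 - real j = - real (j - a - 1)" and lt: "b > j - a - 1"
      using n j by (auto simp: of_nat_diff)
    show ?thesis
      unfolding shift using pochhammer_of_nat_eq_0_lemma[OF lt, where ?'a = real] False by simp
  qed
  finally show ?thesis unfolding c_def by (auto simp: algebra_simps)
qed

text \<open>
  The product of \<open>D\<close> and the \<open>4F3\<close> in two variables; the hypergeometric factor is a Racah polynomial.
\<close>

definition racah_coeff :: "real \<Rightarrow> real \<Rightarrow> real \<Rightarrow> nat \<Rightarrow> nat \<Rightarrow> nat \<Rightarrow> real" where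
  "racah_coeff \<kappa>\<^sub>1 \<kappa>\<^sub>2 \<kappa>\<^sub>3 n j m = conn_const \<kappa>\<^sub>1 \<kappa>\<^sub>2 \<kappa>\<^sub>3 n j m *
     hypergeo_upto (min m j)
       [- real m, real m + \<kappa>\<^sub>2 + \<kappa>\<^sub>3 + 1, - real j, real j + \<kappa>\<^sub>1 + \<kappa>\<^sub>3 + 1]
       [- real n, \<kappa>\<^sub>3 + 1, real n + (\<kappa>\<^sub>1 + \<kappa>\<^sub>2 + \<kappa>\<^sub>3) + 2] 1"

text \<open>
  A cut-off that does not depend on \<open>m\<close> and \<open>j\<close> is needed in order to interchange the sums; beyond
  \<open>min m j\<close> the numerator vanishes.
\<close>

lemma hypergeo_upto_extend:
  assumes "m \<le> b"
  shows "hypergeo_upto (min m j) [- real m, x, - real j, y] [u, v, w] 1 =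
    (\<Sum>k\<le>b. (pochhammer (- real j) k * pochhammer y k / (pochhammer u k * fact k)) *
       (pochhammer (- real m) k * pochhammer x k / (pochhammer v k * pochhammer w k)))"
proof -
  have "hypergeo_upto (min m j) [- real m, x, - real j, y] [u, v, w] 1 =
    (\<Sum>k\<le>min m j. (pochhammer (- real j) k * pochhammer y k / (pochhammer u k * fact k)) *
       (pochhammer (- real m) k * pochhammer x k / (pochhammer v k * pochhammer w k)))"
    unfolding hypergeo_upto_def by (intro sum.cong refl) (simp add: mult_ac)
  also have "\<dots> = (\<Sum>k\<le>b. (pochhammer (- real j) k * pochhammer y k / (pochhammer u k * fact k)) *
       (pochhammer (- real m) k * pochhammer x k / (pochhammer v k * pochhammer w k)))"
    using assms
    by (intro sum.mono_neutral_left) (auto simp: min_def pochhammer_of_nat_eq_0_lemma split: if_splits)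
  finally show ?thesis .
qed

text \<open>
  On the face, the \<open>m\<close>-dependent denominators of \<open>D\<close> and the coefficients of the basis combine to
  the very well-poised weight with parameter \<open>\<kappa>\<^sub>2 + \<kappa>\<^sub>3 + 1\<close>.
\<close>

lemma conn_const_ternary_coeff_face:
  assumes \<kappa>: "\<kappa>\<^sub>2 > -1" "\<kappa>\<^sub>3 > -1" and ab: "a + b = n" and mb: "m \<le> b"
  shows "conn_const \<kappa>\<^sub>1 \<kappa>\<^sub>2 \<kappa>\<^sub>3 n j m * ternary_coeff n m \<kappa>\<^sub>1 \<kappa>\<^sub>2 \<kappa>\<^sub>3 a b 0 =
    pochhammer (- real n) j * pochhammer (\<kappa>\<^sub>2 + 1) (n - j) * pochhammer (\<kappa>\<^sub>3 + 1) j / fact j *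
      ((-1) ^ (n + b) * pochhammer (\<kappa>\<^sub>2 + 1) b) *
    (wp_weight b (\<kappa>\<^sub>2 + \<kappa>\<^sub>3 + 1) m * (-1) ^ m * pochhammer (\<kappa>\<^sub>1 + 1) (n - m) *
      (pochhammer (\<kappa>\<^sub>3 + 1) m * pochhammer (real n + (\<kappa>\<^sub>1 + \<kappa>\<^sub>2 + \<kappa>\<^sub>3) + 2) m / pochhammer (\<kappa>\<^sub>2 + 1) m))"
proof -
  define A where "A = \<kappa>\<^sub>2 + \<kappa>\<^sub>3 + 2 * real m + 2"
  define P where "P = pochhammer (\<kappa>\<^sub>2 + \<kappa>\<^sub>3 + real m + real b + 2) a"
  have "P > 0" unfolding P_def using \<kappa> by (intro pochhammer_pos) simp
  have len: "b - m + a = n - m" using ab mb by auto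
  have A: "pochhammer A (n - m) = pochhammer A (b - m) * P"
    using pochhammer_product'[of A "b - m" a, unfolded len] mb
    by (simp add: A_def P_def of_nat_diff algebra_simps)
  have w: "wp_weight b (\<kappa>\<^sub>2 + \<kappa>\<^sub>3 + 1) m = (-1) ^ m * real (b choose m) /
      (pochhammer (\<kappa>\<^sub>2 + \<kappa>\<^sub>3 + real m + 1) m * pochhammer A (b - m))"
    by (simp add: wp_weight_def A_def algebra_simps)
  have sgn: "(-1) ^ (n + m) * (-1) ^ (b - m) = ((-1) ^ (n + b) :: real)" "(-1) ^ m * (-1) ^ m = (1 :: real)"
    using mb by (simp_all add: power_add[symmetric] minus_one_power_iff)
  have "conn_const \<kappa>\<^sub>1 \<kappa>\<^sub>2 \<kappa>\<^sub>3 n j m * ternary_coeff n m \<kappa>\<^sub>1 \<kappa>\<^sub>2 \<kappa>\<^sub>3 a b 0 =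
    pochhammer (- real n) j * pochhammer (\<kappa>\<^sub>2 + 1) (n - j) * pochhammer (\<kappa>\<^sub>3 + 1) j / fact j *
      (((-1) ^ (n + m) * (-1) ^ (b - m)) * pochhammer (\<kappa>\<^sub>2 + 1) b) *
    (real (b choose m) / (pochhammer (\<kappa>\<^sub>2 + \<kappa>\<^sub>3 + real m + 1) m * pochhammer A (b - m)) *
      pochhammer (\<kappa>\<^sub>1 + 1) (n - m) *
      (pochhammer (\<kappa>\<^sub>3 + 1) m * pochhammer (real n + (\<kappa>\<^sub>1 + \<kappa>\<^sub>2 + \<kappa>\<^sub>3) + 2) m / pochhammer (\<kappa>\<^sub>2 + 1) m))"
    unfolding conn_const_def ternary_coeff_face[OF \<kappa> ab] A_def[symmetric] P_def[symmetric] A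
    using \<open>P > 0\<close> by (simp add: mult_ac)
  also have "real (b choose m) / (pochhammer (\<kappa>\<^sub>2 + \<kappa>\<^sub>3 + real m + 1) m * pochhammer A (b - m)) =
      wp_weight b (\<kappa>\<^sub>2 + \<kappa>\<^sub>3 + 1) m * (-1) ^ m"
    unfolding w using sgn(2) by simp
  finally show ?thesis unfolding sgn(1) .
qed

text \<open>
  The coefficient of the face monomial with exponents \<open>a\<close> and \<open>b\<close>. Once the \<open>4F3\<close> is written out and
  the sums are interchanged, both of them are summable in closed form.
\<close>

lemma racah_coeff_face:
  assumes \<kappa>: "\<kappa>\<^sub>1 > -1" "\<kappa>\<^sub>2 > -1" "\<kappa>\<^sub>3 > -1" and ab: "a + b = n" and j: "j \<le> n"
  shows "(\<Sum>m\<le>n. racah_coeff \<kappa>\<^sub>1 \<kappa>\<^sub>2 \<kappa>\<^sub>3 n j m * ternary_coeff n m \<kappa>\<^sub>1 \<kappa>\<^sub>2 \<kappa>\<^sub>3 a b 0) =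
    ternary_coeff n j \<kappa>\<^sub>2 \<kappa>\<^sub>1 \<kappa>\<^sub>3 b a 0"
proof -
  define \<rho> a\<^sub>0 where "\<rho> = real n + (\<kappa>\<^sub>1 + \<kappa>\<^sub>2 + \<kappa>\<^sub>3) + 2" and "a\<^sub>0 = \<kappa>\<^sub>2 + \<kappa>\<^sub>3 + 1"
  define R where "R = pochhammer (- real n) j * pochhammer (\<kappa>\<^sub>2 + 1) (n - j) * pochhammer (\<kappa>\<^sub>3 + 1) j / fact j *
      ((-1) ^ (n + b) * pochhammer (\<kappa>\<^sub>2 + 1) b)"
  define q where "q = (\<lambda>k. pochhammer (- real j) k * pochhammer (real j + \<kappa>\<^sub>1 + \<kappa>\<^sub>3 + 1) k /
      (pochhammer (- real n) k * fact k))"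
  define T where "T = (\<lambda>k m. wp_weight b a\<^sub>0 m * (-1) ^ m * pochhammer (\<kappa>\<^sub>1 + 1) (n - m) *
      (pochhammer (\<kappa>\<^sub>3 + 1) m * pochhammer \<rho> m / pochhammer (\<kappa>\<^sub>2 + 1) m) *
      (pochhammer (- real m) k * pochhammer (a\<^sub>0 + real m) k /
        (pochhammer (\<kappa>\<^sub>3 + 1) k * pochhammer \<rho> k)))"
  have "(\<Sum>m\<le>n. racah_coeff \<kappa>\<^sub>1 \<kappa>\<^sub>2 \<kappa>\<^sub>3 n j m * ternary_coeff n m \<kappa>\<^sub>1 \<kappa>\<^sub>2 \<kappa>\<^sub>3 a b 0) =
      (\<Sum>m\<le>b. racah_coeff \<kappa>\<^sub>1 \<kappa>\<^sub>2 \<kappa>\<^sub>3 n j m * ternary_coeff n m \<kappa>\<^sub>1 \<kappa>\<^sub>2 \<kappa>\<^sub>3 a b 0)"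
    by (rule sum.mono_neutral_right) (use ab in \<open>auto simp: ternary_coeff_face[OF \<kappa>(2,3) ab] binomial_eq_0\<close>)
  also have "\<dots> = (\<Sum>m\<le>b. \<Sum>k\<le>b. R * (q k * T k m))"
  proof (intro sum.cong refl)
    fix m assume "m \<in> {..b}"
    then have m: "m \<le> b" by simp
    have args: "real m + \<kappa>\<^sub>2 + \<kappa>\<^sub>3 + 1 = a\<^sub>0 + real m" by (simp add: a\<^sub>0_def)
    have "racah_coeff \<kappa>\<^sub>1 \<kappa>\<^sub>2 \<kappa>\<^sub>3 n j m * ternary_coeff n m \<kappa>\<^sub>1 \<kappa>\<^sub>2 \<kappa>\<^sub>3 a b 0 =
      (conn_const \<kappa>\<^sub>1 \<kappa>\<^sub>2 \<kappa>\<^sub>3 n j m * ternary_coeff n m \<kappa>\<^sub>1 \<kappa>\<^sub>2 \<kappa>\<^sub>3 a b 0) *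
        (\<Sum>k\<le>b. q k * (pochhammer (- real m) k * pochhammer (a\<^sub>0 + real m) k /
        (pochhammer (\<kappa>\<^sub>3 + 1) k * pochhammer \<rho> k)))"
      unfolding racah_coeff_def hypergeo_upto_extend[OF m] q_def \<rho>_def[symmetric] args by simp
    also have "\<dots> = (\<Sum>k\<le>b. R * (q k * T k m))"
      unfolding conn_const_ternary_coeff_face[OF \<kappa>(2,3) ab m] sum_distrib_left R_def[symmetric]
        \<rho>_def[symmetric] a\<^sub>0_def[symmetric] T_def
      by (intro sum.cong refl) (simp only: mult_ac)
    finally show "racah_coeff \<kappa>\<^sub>1 \<kappa>\<^sub>2 \<kappa>\<^sub>3 n j m * ternary_coeff n m \<kappa>\<^sub>1 \<kappa>\<^sub>2 \<kappa>\<^sub>3 a b 0 =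
      (\<Sum>k\<le>b. R * (q k * T k m))" .
  qed
  also have "\<dots> = (\<Sum>k\<le>b. R * (q k * (\<Sum>m\<le>b. T k m)))"
    by (subst sum.swap) (simp add: sum_distrib_left)
  also have "\<dots> = (\<Sum>k\<le>b. R * pochhammer (\<kappa>\<^sub>1 + 1) a / pochhammer (\<kappa>\<^sub>2 + 1) b *
      ((-1) ^ k * (fact b / fact (b - k)) *
       pochhammer (\<kappa>\<^sub>1 + \<kappa>\<^sub>3 + real a + 2 + real k) (b - k) * q k))"
  proof (intro sum.cong refl)
    fix k assume "k \<in> {..b}"
    then have "k \<le> b" by simp
    from wp_weight_sum[OF \<kappa> this ab \<rho>_def a\<^sub>0_def]
    show "R * (q k * (\<Sum>m\<le>b. T k m)) = R * pochhammer (\<kappa>\<^sub>1 + 1) a / pochhammer (\<kappa>\<^sub>2 + 1) b *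
      ((-1) ^ k * (fact b / fact (b - k)) *
       pochhammer (\<kappa>\<^sub>1 + \<kappa>\<^sub>3 + real a + 2 + real k) (b - k) * q k)"
      unfolding T_def by (simp add: mult_ac)
  qed
  also have "\<dots> = R * pochhammer (\<kappa>\<^sub>1 + 1) a / pochhammer (\<kappa>\<^sub>2 + 1) b *
      (if j \<le> a then fact a * fact (n - j) / (fact n * fact (a - j)) *
       pochhammer (\<kappa>\<^sub>1 + \<kappa>\<^sub>3 + real j + real a + 2) b else 0)"
    unfolding sum_distrib_left[symmetric] q_def saalschutz_sum[OF ab j] ..
  also have "\<dots> = ternary_coeff n j \<kappa>\<^sub>2 \<kappa>\<^sub>1 \<kappa>\<^sub>3 b a 0"
  proof (cases "j \<le> a")
    case False
    then show ?thesis using ab by (simp add: ternary_coeff_def)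
  next
    case True
    have ba: "b + a = n" using ab by simp
    have "pochhammer (\<kappa>\<^sub>2 + 1) b > 0" using \<kappa> by (intro pochhammer_pos) simp
    moreover have "(-1) ^ j * (-1) ^ (n + b) = ((-1) ^ (a - j) :: real)"
      using True ab by (auto simp: power_add[symmetric] minus_one_power_iff)
    ultimately show ?thesis
      unfolding ternary_coeff_face[OF \<kappa>(1,3) ba] R_def pochhammer_minus_nat_fact[OF j] using True
      by (simp add: binomial_fact mult_ac)
  qed
  finally show ?thesis .
qed

text \<open>
  Both sides are in the kernel of the operator, which is invariant under a simultaneous
  exchange of variables and parameters, and they agree on the face \<open>z = 0\<close>.
\<close>

lemma ternary_form_swap:
  assumes \<kappa>: "\<kappa>\<^sub>1 > -1" "\<kappa>\<^sub>2 > -1" "\<kappa>\<^sub>3 > -1" and j: "j \<le> n"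
  shows "ternary_form n j \<kappa>\<^sub>2 \<kappa>\<^sub>1 \<kappa>\<^sub>3 y x z =
    (\<Sum>m\<le>n. racah_coeff \<kappa>\<^sub>1 \<kappa>\<^sub>2 \<kappa>\<^sub>3 n j m * ternary_form n m \<kappa>\<^sub>1 \<kappa>\<^sub>2 \<kappa>\<^sub>3 x y z)"
proof -
  let ?M = "\<lambda>a b c. norm_monomial \<kappa>\<^sub>1 a x * norm_monomial \<kappa>\<^sub>2 b y * norm_monomial \<kappa>\<^sub>3 c z"
  define f where "f = (\<lambda>a b c. ternary_coeff n j \<kappa>\<^sub>2 \<kappa>\<^sub>1 \<kappa>\<^sub>3 b a c)"
  define g where "g = (\<lambda>a b c. \<Sum>m\<le>n. racah_coeff \<kappa>\<^sub>1 \<kappa>\<^sub>2 \<kappa>\<^sub>3 n j m * ternary_coeff n m \<kappa>\<^sub>1 \<kappa>\<^sub>2 \<kappa>\<^sub>3 a b c)"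
  have f: "laplace_coeffs n f"
    unfolding laplace_coeffs_def
  proof (intro allI impI)
    fix a b c assume "a + b + c + 1 = n"
    then have "b + a + c + 1 = n" by simp
    then have "ternary_coeff n j \<kappa>\<^sub>2 \<kappa>\<^sub>1 \<kappa>\<^sub>3 (Suc b) a c + ternary_coeff n j \<kappa>\<^sub>2 \<kappa>\<^sub>1 \<kappa>\<^sub>3 b (Suc a) c +
        ternary_coeff n j \<kappa>\<^sub>2 \<kappa>\<^sub>1 \<kappa>\<^sub>3 b a (Suc c) = 0"
      using laplace_coeffs_ternary_coeff[OF \<kappa>(1,3), of n j \<kappa>\<^sub>2] unfolding laplace_coeffs_def by blast
    then show "f (Suc a) b c + f a (Suc b) c + f a b (Suc c) = 0" unfolding f_def by linarith
  qed
  have g: "laplace_coeffs n g"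
    unfolding laplace_coeffs_def
  proof (intro allI impI)
    fix a b c assume abc: "a + b + c + 1 = n"
    have "g (Suc a) b c + g a (Suc b) c + g a b (Suc c) = (\<Sum>m\<le>n. racah_coeff \<kappa>\<^sub>1 \<kappa>\<^sub>2 \<kappa>\<^sub>3 n j m *
        (ternary_coeff n m \<kappa>\<^sub>1 \<kappa>\<^sub>2 \<kappa>\<^sub>3 (Suc a) b c + ternary_coeff n m \<kappa>\<^sub>1 \<kappa>\<^sub>2 \<kappa>\<^sub>3 a (Suc b) c +
         ternary_coeff n m \<kappa>\<^sub>1 \<kappa>\<^sub>2 \<kappa>\<^sub>3 a b (Suc c)))"
      by (simp add: g_def sum.distrib distrib_left)
    also have "\<dots> = 0"
      using laplace_coeffs_ternary_coeff[OF \<kappa>(2,3), of n _ \<kappa>\<^sub>1] abc unfolding laplace_coeffs_def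
      by (intro sum.neutral) auto
    finally show "g (Suc a) b c + g a (Suc b) c + g a b (Suc c) = 0" .
  qed
  have fg: "f a b c = g a b c" if "a + b + c = n" for a b c
    using laplace_coeffs_face_eqI[OF f g _ that] racah_coeff_face[OF \<kappa> _ j] by (simp add: f_def g_def)
  have "ternary_form n j \<kappa>\<^sub>2 \<kappa>\<^sub>1 \<kappa>\<^sub>3 y x z = (\<Sum>b\<le>n. \<Sum>c\<le>n - b. f (n - b - c) b c * ?M (n - b - c) b c)"
    unfolding ternary_form_expansion[OF \<kappa>(2,1,3) j] f_def by (simp add: mult_ac)
  also have "\<dots> = (\<Sum>a\<le>n. \<Sum>c\<le>n - a. f a (n - a - c) c * ?M a (n - a - c) c)"
    unfolding sum_triangle
    by (rule sum.reindex_bij_witness[of _ "\<lambda>(a, c). (n - a - c, c)" "\<lambda>(a, c). (n - a - c, c)"]) auto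
  also have "\<dots> = (\<Sum>a\<le>n. \<Sum>c\<le>n - a. g a (n - a - c) c * ?M a (n - a - c) c)"
    by (intro sum.cong refl arg_cong2[where f = "(*)"] fg) auto
  also have "\<dots> = (\<Sum>a\<le>n. \<Sum>c\<le>n - a. \<Sum>m\<le>n. racah_coeff \<kappa>\<^sub>1 \<kappa>\<^sub>2 \<kappa>\<^sub>3 n j m *
      (ternary_coeff n m \<kappa>\<^sub>1 \<kappa>\<^sub>2 \<kappa>\<^sub>3 a (n - a - c) c * ?M a (n - a - c) c))"
    unfolding g_def sum_distrib_right by (simp only: mult.assoc)
  also have "\<dots> = (\<Sum>m\<le>n. \<Sum>a\<le>n. \<Sum>c\<le>n - a. racah_coeff \<kappa>\<^sub>1 \<kappa>\<^sub>2 \<kappa>\<^sub>3 n j m *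
      (ternary_coeff n m \<kappa>\<^sub>1 \<kappa>\<^sub>2 \<kappa>\<^sub>3 a (n - a - c) c * ?M a (n - a - c) c))"
    unfolding sum.swap[of _ "{..n}" "{..n - _}"] by (rule sum.swap)
  also have "\<dots> = (\<Sum>m\<le>n. racah_coeff \<kappa>\<^sub>1 \<kappa>\<^sub>2 \<kappa>\<^sub>3 n j m * ternary_form n m \<kappa>\<^sub>1 \<kappa>\<^sub>2 \<kappa>\<^sub>3 x y z)"
    by (intro sum.cong refl) (simp add: ternary_form_expansion[OF \<kappa>] sum_distrib_left)
  finally show ?thesis .
qed

section \<open>Connection coefficients in two and three variables\<close>

lemma sum_multi_indices_2:
  "(\<Sum>\<mu>\<in>multi_indices 2 n. F \<mu>) = (\<Sum>m\<le>n. F (pair_index (n - m) m))"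
proof (rule sum.reindex_bij_witness[of _ "\<lambda>m. pair_index (n - m) m" "\<lambda>\<mu>. \<mu> 2"])
  fix \<mu> assume \<mu>: "\<mu> \<in> multi_indices 2 n"
  have "{1..2::nat} = {1, 2}" by auto
  with \<mu> have sum: "\<mu> 1 + \<mu> 2 = n" and supp: "\<And>i. i \<notin> {1, 2} \<Longrightarrow> \<mu> i = 0"
    by (auto simp: multi_indices_def)
  show eq: "pair_index (n - \<mu> 2) (\<mu> 2) = \<mu>"
    using sum supp by (auto simp: pair_index_def fun_eq_iff)
  show "\<mu> 2 \<in> {..n}" using sum by simp
  show "F (pair_index (n - \<mu> 2) (\<mu> 2)) = F \<mu>" unfolding eq ..
next
  fix m assume "m \<in> {..n}"
  moreover have "{1..2::nat} = {1, 2}" by auto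
  ultimately show "pair_index (n - m) m \<in> multi_indices 2 n" "pair_index (n - m) m 2 = m"
    by (auto simp: multi_indices_def pair_index_def)
qed

definition triple_index :: "nat \<Rightarrow> nat \<Rightarrow> nat \<Rightarrow> nat \<Rightarrow> nat" where
  "triple_index a b c = (\<lambda>_. 0)(1 := a, 2 := b, 3 := c)"

lemma multi_indices_3_iff:
  "\<mu> \<in> multi_indices 3 n \<longleftrightarrow> \<mu> = triple_index (\<mu> 1) (\<mu> 2) (\<mu> 3) \<and> \<mu> 1 + \<mu> 2 + \<mu> 3 = n"
proof -
  have "{1..3::nat} = {1, 2, 3}" by auto
  then show ?thesis by (auto simp: multi_indices_def triple_index_def fun_eq_iff)
qed

lemma sum_multi_indices_3:
  fixes F :: "(nat \<Rightarrow> nat) \<Rightarrow> real"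
  assumes l: "l \<le> n"
  shows "(\<Sum>\<mu>\<in>multi_indices 3 n. of_bool (l = \<mu> 3) * F \<mu>) =
    (\<Sum>m\<le>n - l. F (triple_index (n - l - m) m l))"
proof -
  have "(\<Sum>\<mu>\<in>multi_indices 3 n. of_bool (l = \<mu> 3) * F \<mu>) =
      (\<Sum>\<mu>\<in>{\<mu> \<in> multi_indices 3 n. \<mu> 3 = l}. F \<mu>)"
    using finite_multi_indices[of 3 n] by (intro sum.mono_neutral_cong_right) auto
  also have "\<dots> = (\<Sum>m\<le>n - l. F (triple_index (n - l - m) m l))"
  proof (rule sum.reindex_bij_witness[of _ "\<lambda>m. triple_index (n - l - m) m l" "\<lambda>\<mu>. \<mu> 2"])
    fix \<mu> assume "\<mu> \<in> {\<mu> \<in> multi_indices 3 n. \<mu> 3 = l}"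
    then have \<mu>: "\<mu> = triple_index (\<mu> 1) (\<mu> 2) l" "\<mu> 1 + \<mu> 2 + l = n"
      using multi_indices_3_iff by auto
    then have "n - l - \<mu> 2 = \<mu> 1" by simp
    then show eq: "triple_index (n - l - \<mu> 2) (\<mu> 2) l = \<mu>" using \<mu>(1) by simp
    show "\<mu> 2 \<in> {..n - l}" using \<mu>(2) by simp
    show "F (triple_index (n - l - \<mu> 2) (\<mu> 2) l) = F \<mu>" unfolding eq ..
  next
    fix m assume "m \<in> {..n - l}"
    then show "triple_index (n - l - m) m l \<in> {\<mu> \<in> multi_indices 3 n. \<mu> 3 = l}"
      "triple_index (n - l - m) m l 2 = m"
      using l by (auto simp: multi_indices_3_iff) (auto simp: triple_index_def)
  qed
  finally show ?thesis .
qed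

lemma simplex_jacobi_2:
  "simplex_jacobi 2 \<kappa> \<mu> x =
     ternary_form (\<mu> 1 + \<mu> 2) (\<mu> 2) (\<kappa> 1) (\<kappa> 2) (\<kappa> 3) (x 1) (x 2) (1 - x 1 - x 2)"
proof -
  have sets: "{1..2::nat} = {1, 2}" "{1 + 1..2 + 1::nat} = {2, 3}" "{1 + 1..2::nat} = {2}"
    "{2 + 1..2 + 1::nat} = {3}" "{2 + 1..2::nat} = {}" "{1..<1::nat} = {}" "{1..<2::nat} = {1}"
    by auto
  have prod: "(\<Prod>j\<in>{1, 2::nat}. f j) = f 1 * f 2" for f :: "nat \<Rightarrow> real" by simp
  have index: "jacobi_index 2 \<kappa> \<mu> 1 = \<kappa> 2 + \<kappa> 3 + 2 * real (\<mu> 2) + 1" "jacobi_index 2 \<kappa> \<mu> 2 = \<kappa> 3"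
    unfolding jacobi_index_def sets by simp_all
  show ?thesis
    unfolding simplex_jacobi_def homog_jacobi ternary_form_def sets prod index
    by (simp add: algebra_simps)
qed

text \<open>
  The index \<open>\<nu>\<^sub>3\<close> enters the first two factors only through the parameter \<open>\<kappa>\<^sub>3 + \<kappa>\<^sub>4 + 2\<nu>\<^sub>3 + 1\<close>.
  The third factor depends on \<open>x\<^sub>3\<close> and on the barycentric coordinate \<open>1 - x\<^sub>1 - x\<^sub>2 - x\<^sub>3\<close> alone.
\<close>

lemma simplex_jacobi_3:
  "simplex_jacobi 3 \<kappa> \<mu> x =
     ternary_form (\<mu> 1 + \<mu> 2) (\<mu> 2) (\<kappa> 1) (\<kappa> 2) (\<kappa> 3 + \<kappa> 4 + 2 * real (\<mu> 3) + 1)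
       (x 1) (x 2) (1 - x 1 - x 2) *
     jacobi_form (\<mu> 3) (\<kappa> 4) (\<kappa> 3) (1 - x 1 - x 2 - x 3) (x 3)"
proof -
  have sets: "{1..3::nat} = {1, 2, 3}" "{1 + 1..3 + 1::nat} = {2, 3, 4}" "{1 + 1..3::nat} = {2, 3}"
    "{2 + 1..3 + 1::nat} = {3, 4}" "{2 + 1..3::nat} = {3}" "{3 + 1..3 + 1::nat} = {4}"
    "{3 + 1..3::nat} = {}" "{1..<1::nat} = {}" "{1..<2::nat} = {1}" "{1..<3::nat} = {1, 2}"
    by auto
  have prod: "(\<Prod>j\<in>{1, 2, 3::nat}. f j) = f 1 * f 2 * f 3" for f :: "nat \<Rightarrow> real" by simp
  have index: "jacobi_index 3 \<kappa> \<mu> 1 = \<kappa> 2 + (\<kappa> 3 + \<kappa> 4 + 2 * real (\<mu> 3) + 1) + 2 * real (\<mu> 2) + 1"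
    "jacobi_index 3 \<kappa> \<mu> 2 = \<kappa> 3 + \<kappa> 4 + 2 * real (\<mu> 3) + 1" "jacobi_index 3 \<kappa> \<mu> 3 = \<kappa> 4"
    unfolding jacobi_index_def sets by simp_all
  show ?thesis
    unfolding simplex_jacobi_def homog_jacobi ternary_form_def sets prod index
    by (simp add: algebra_simps)
qed

lemma conn_coeff2_transpose_12:
  assumes \<kappa>: "\<And>i. i \<in> {1..3} \<Longrightarrow> \<kappa> i > -1" and jm: "j \<le> n" "m \<le> n"
  shows "conn_coeff2 (transpose 1 2) \<kappa> n j m = racah_coeff (\<kappa> 1) (\<kappa> 2) (\<kappa> 3) n j m"
proof -
  let ?\<tau> = "transpose 1 2 :: nat \<Rightarrow> nat"
  let ?R = "racah_coeff (\<kappa> 1) (\<kappa> 2) (\<kappa> 3) n j"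
  define c where "c = (\<lambda>\<mu>. if \<mu> \<in> multi_indices 2 n then ?R (\<mu> 2) else 0)"
  have mem: "pair_index (n - k) k \<in> multi_indices 2 n" if "k \<le> n" for k
  proof -
    have "{1..2::nat} = {1, 2}" by auto
    with that show ?thesis by (simp add: multi_indices_def pair_index_def)
  qed
  have "conn_coeff 2 ?\<tau> \<kappa> (pair_index (n - j) j) = c"
  proof (rule conn_coeff_eqI[OF _ mem[OF jm(1)]])
    show "\<kappa> i > -1" if "i \<in> {1..2 + 1}" for i using \<kappa> that by simp
    show "c \<mu> = 0" if "\<mu> \<notin> multi_indices 2 n" for \<mu> using that by (simp add: c_def)
    fix x
    have vals: "(\<kappa> \<circ> ?\<tau>) 1 = \<kappa> 2" "(\<kappa> \<circ> ?\<tau>) 2 = \<kappa> 1" "(\<kappa> \<circ> ?\<tau>) 3 = \<kappa> 3"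
      "(simplex_ext 2 x \<circ> ?\<tau>) 1 = x 2" "(simplex_ext 2 x \<circ> ?\<tau>) 2 = x 1"
      by (simp_all add: transpose_def simplex_ext_def)
    have idx: "pair_index (n - k) k 1 = n - k" "pair_index (n - k) k 2 = k" "n - k + k = n"
      if "k \<le> n" for k using that by (simp_all add: pair_index_def)
    have "simplex_jacobi 2 (\<kappa> \<circ> ?\<tau>) (pair_index (n - j) j) (simplex_ext 2 x \<circ> ?\<tau>) =
        ternary_form n j (\<kappa> 2) (\<kappa> 1) (\<kappa> 3) (x 2) (x 1) (1 - x 1 - x 2)"
      unfolding simplex_jacobi_2 idx[OF jm(1)] vals by (simp add: algebra_simps)
    also have "\<dots> = (\<Sum>k\<le>n. ?R k * ternary_form n k (\<kappa> 1) (\<kappa> 2) (\<kappa> 3) (x 1) (x 2) (1 - x 1 - x 2))"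
      by (rule ternary_form_swap) (use \<kappa> jm in auto)
    also have "\<dots> = (\<Sum>\<mu>\<in>multi_indices 2 n. c \<mu> * simplex_jacobi 2 \<kappa> \<mu> x)"
      unfolding sum_multi_indices_2 simplex_jacobi_2
    proof (intro sum.cong refl)
      fix k assume "k \<in> {..n}"
      then have k: "k \<le> n" by simp
      show "?R k * ternary_form n k (\<kappa> 1) (\<kappa> 2) (\<kappa> 3) (x 1) (x 2) (1 - x 1 - x 2) =
          c (pair_index (n - k) k) * ternary_form (pair_index (n - k) k 1 + pair_index (n - k) k 2)
            (pair_index (n - k) k 2) (\<kappa> 1) (\<kappa> 2) (\<kappa> 3) (x 1) (x 2) (1 - x 1 - x 2)"
        unfolding idx[OF k] by (simp add: c_def mem k idx(2))
    qed
    finally show "simplex_jacobi 2 (\<kappa> \<circ> ?\<tau>) (pair_index (n - j) j) (simplex_ext 2 x \<circ> ?\<tau>) =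
        (\<Sum>\<mu>\<in>multi_indices 2 n. c \<mu> * simplex_jacobi 2 \<kappa> \<mu> x)" .
  qed
  then show ?thesis
    unfolding conn_coeff2_def by (simp add: c_def mem jm) (simp add: pair_index_def)
qed

lemma simplex_jacobi_3_transpose_12:
  assumes \<kappa>: "\<And>i. i \<in> {1..4} \<Longrightarrow> \<kappa> i > -1" and \<nu>: "\<nu> \<in> multi_indices 3 n"
  shows "simplex_jacobi 3 (\<kappa> \<circ> transpose 1 2) \<nu> (simplex_ext 3 x \<circ> transpose 1 2) =
    (\<Sum>\<mu>\<in>multi_indices 3 n. of_bool (\<nu> 3 = \<mu> 3) *
       racah_coeff (\<kappa> 1) (\<kappa> 2) (\<kappa> 3 + \<kappa> 4 + 2 * real (\<nu> 3) + 1) (n - \<nu> 3) (\<nu> 2) (\<mu> 2) *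
       simplex_jacobi 3 \<kappa> \<mu> x)"
proof -
  let ?\<tau> = "transpose 1 2 :: nat \<Rightarrow> nat"
  define N k3 where "N = n - \<nu> 3" and "k3 = \<kappa> 3 + \<kappa> 4 + 2 * real (\<nu> 3) + 1"
  have N: "\<nu> 1 + \<nu> 2 = N" "\<nu> 3 \<le> n" "\<nu> 2 \<le> N"
    using \<nu> by (auto simp: multi_indices_3_iff N_def)
  have vals: "(\<kappa> \<circ> ?\<tau>) 1 = \<kappa> 2" "(\<kappa> \<circ> ?\<tau>) 2 = \<kappa> 1" "(\<kappa> \<circ> ?\<tau>) 3 = \<kappa> 3" "(\<kappa> \<circ> ?\<tau>) 4 = \<kappa> 4"
    "(simplex_ext 3 x \<circ> ?\<tau>) 1 = x 2" "(simplex_ext 3 x \<circ> ?\<tau>) 2 = x 1" "(simplex_ext 3 x \<circ> ?\<tau>) 3 = x 3"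
    by (simp_all add: transpose_def simplex_ext_def)
  let ?J = "jacobi_form (\<nu> 3) (\<kappa> 4) (\<kappa> 3) (1 - x 1 - x 2 - x 3) (x 3)"
  have "simplex_jacobi 3 (\<kappa> \<circ> ?\<tau>) \<nu> (simplex_ext 3 x \<circ> ?\<tau>) =
      ternary_form N (\<nu> 2) (\<kappa> 2) (\<kappa> 1) k3 (x 2) (x 1) (1 - x 1 - x 2) * ?J"
    unfolding simplex_jacobi_3 vals N(1) k3_def by (simp add: algebra_simps)
  also have "ternary_form N (\<nu> 2) (\<kappa> 2) (\<kappa> 1) k3 (x 2) (x 1) (1 - x 1 - x 2) =
      (\<Sum>m\<le>N. racah_coeff (\<kappa> 1) (\<kappa> 2) k3 N (\<nu> 2) m *
         ternary_form N m (\<kappa> 1) (\<kappa> 2) k3 (x 1) (x 2) (1 - x 1 - x 2))"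
  proof (rule ternary_form_swap)
    show "k3 > -1" using \<kappa>[of 3] \<kappa>[of 4] by (simp add: k3_def)
  qed (use \<kappa> N in auto)
  also have "\<dots> * ?J = (\<Sum>m\<le>N. racah_coeff (\<kappa> 1) (\<kappa> 2) k3 N (\<nu> 2) m *
         simplex_jacobi 3 \<kappa> (triple_index (N - m) m (\<nu> 3)) x)"
    unfolding sum_distrib_right simplex_jacobi_3
    by (intro sum.cong refl) (simp add: triple_index_def k3_def mult_ac)
  also have "\<dots> = (\<Sum>m\<le>N. racah_coeff (\<kappa> 1) (\<kappa> 2) k3 N (\<nu> 2) (triple_index (N - m) m (\<nu> 3) 2) *
         simplex_jacobi 3 \<kappa> (triple_index (N - m) m (\<nu> 3)) x)"
    by (simp add: triple_index_def)
  also have "\<dots> = (\<Sum>\<mu>\<in>multi_indices 3 n. of_bool (\<nu> 3 = \<mu> 3) *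
       (racah_coeff (\<kappa> 1) (\<kappa> 2) k3 N (\<nu> 2) (\<mu> 2) * simplex_jacobi 3 \<kappa> \<mu> x))"
    unfolding N_def by (rule sum_multi_indices_3[OF N(2), symmetric])
  finally show ?thesis unfolding N_def k3_def by (simp only: mult.assoc)
qed

text \<open>
  The permutation \<open>\<sigma>\<close> is the identity or \<open>(12)\<close>. Since \<open>1 - x\<^sub>1 - x\<^sub>2\<close> does not change under \<open>\<sigma>\<close>,
  the third factor is the same form in \<open>x\<^sub>3\<close> and \<open>x\<^sub>4\<close> in both cases, and \<open>(34)\<close> reflects it.
\<close>

lemma simplex_jacobi_3_comp_transpose_34:
  assumes \<sigma>: "\<sigma> 3 = 3" "\<sigma> 4 = 4" "\<sigma> 1 \<in> {1, 2}" "\<sigma> 2 \<in> {1, 2}" "\<sigma> 1 \<noteq> \<sigma> 2"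
  shows "simplex_jacobi 3 (\<kappa> \<circ> (\<sigma> \<circ> transpose 3 4)) \<nu> (simplex_ext 3 x \<circ> (\<sigma> \<circ> transpose 3 4)) =
    (-1) ^ \<nu> 3 * simplex_jacobi 3 (\<kappa> \<circ> \<sigma>) \<nu> (simplex_ext 3 x \<circ> \<sigma>)"
proof -
  let ?\<tau> = "\<sigma> \<circ> transpose 3 4"
  have "{1..3::nat} = {1, 2, 3}" by auto
  then have ext: "simplex_ext 3 x 4 = 1 - x 1 - x 2 - x 3" "simplex_ext 3 x (\<sigma> 1) = x (\<sigma> 1)"
    "simplex_ext 3 x (\<sigma> 2) = x (\<sigma> 2)" "simplex_ext 3 x 3 = x 3"
    using \<sigma> by (auto simp: simplex_ext_def)
  have x12: "1 - x (\<sigma> 1) - x (\<sigma> 2) = 1 - x 1 - x 2" using \<sigma> by auto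
  have t: "?\<tau> 1 = \<sigma> 1" "?\<tau> 2 = \<sigma> 2" "?\<tau> 3 = 4" "?\<tau> 4 = 3"
    by (simp_all add: transpose_def \<sigma>)
  have k: "\<kappa> 4 + \<kappa> 3 = \<kappa> 3 + \<kappa> 4" by simp
  have s: "1 - x 1 - x 2 - (1 - x 1 - x 2 - x 3) = x 3" by simp
  show ?thesis
    unfolding simplex_jacobi_3 o_apply[of \<kappa>] o_apply[of "simplex_ext 3 x"] t ext \<sigma>(1,2) x12 k s
    by (subst jacobi_form_swap) simp
qed

theorem proposition5p1:
  fixes \<kappa> :: "nat \<Rightarrow> real" and \<nu> \<mu> :: "nat \<Rightarrow> nat" and n :: nat
    and \<kappa>3' :: real and \<kappa>' :: "nat \<Rightarrow> real"
  assumes \<kappa>: "\<And>i. i \<in> {1..4} \<Longrightarrow> \<kappa> i > -1"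
    and \<nu>: "\<nu> \<in> multi_indices 3 n"
    and \<mu>: "\<mu> \<in> multi_indices 3 n"
    and \<kappa>3': "\<kappa>3' = \<kappa> 3 + \<kappa> 4 + 2 * real (\<nu> 3) + 1"
    and \<kappa>': "\<kappa>' = \<kappa>(3 := \<kappa>3')"
  shows "conn_coeff 3 (transpose 1 2) \<kappa> \<nu> \<mu> =
           of_bool (\<nu> 3 = \<mu> 3) * conn_coeff2 (transpose 1 2) \<kappa>' (n - \<nu> 3) (\<nu> 2) (\<mu> 2) \<and>
         of_bool (\<nu> 3 = \<mu> 3) * conn_coeff2 (transpose 1 2) \<kappa>' (n - \<nu> 3) (\<nu> 2) (\<mu> 2) =
           of_bool (\<nu> 3 = \<mu> 3) * conn_const (\<kappa> 1) (\<kappa> 2) \<kappa>3' (n - \<nu> 3) (\<nu> 2) (\<mu> 2) *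
           hypergeo_upto (min (\<mu> 2) (\<nu> 2))
             [- real (\<mu> 2), real (\<mu> 2) + \<kappa> 2 + \<kappa>3' + 1,
              - real (\<nu> 2), real (\<nu> 2) + \<kappa> 1 + \<kappa>3' + 1]
             [- real n + real (\<nu> 3), \<kappa>3' + 1, real n + real (\<nu> 3) + (\<Sum>i=1..4. \<kappa> i) + 3]
             1 \<and>
         conn_coeff 3 (transpose 3 4) \<kappa> \<nu> \<mu> = (-1) ^ \<nu> 3 * of_bool (\<nu> = \<mu>) \<and>
         conn_coeff 3 (transpose 1 2 \<circ> transpose 3 4) \<kappa> \<nu> \<mu> =
           (-1) ^ \<nu> 3 * conn_coeff 3 (transpose 1 2) \<kappa> \<nu> \<mu>"
proof (intro conjI)
  define R where "R = (\<lambda>\<mu>::nat \<Rightarrow> nat. racah_coeff (\<kappa> 1) (\<kappa> 2) \<kappa>3' (n - \<nu> 3) (\<nu> 2) (\<mu> 2))"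
  define c where "c = (\<lambda>\<mu>. if \<mu> \<in> multi_indices 3 n then of_bool (\<nu> 3 = \<mu> 3) * R \<mu> else 0)"
  have \<kappa>_gt: "\<kappa> i > -1" if "i \<in> {1..3 + 1}" for i using \<kappa> that by simp
  have c_expansion: "simplex_jacobi 3 (\<kappa> \<circ> transpose 1 2) \<nu> (simplex_ext 3 x \<circ> transpose 1 2) =
      (\<Sum>\<mu>\<in>multi_indices 3 n. c \<mu> * simplex_jacobi 3 \<kappa> \<mu> x)" for x
  proof -
    have "(\<Sum>\<mu>\<in>multi_indices 3 n. c \<mu> * simplex_jacobi 3 \<kappa> \<mu> x) =
        (\<Sum>\<mu>\<in>multi_indices 3 n. of_bool (\<nu> 3 = \<mu> 3) * R \<mu> * simplex_jacobi 3 \<kappa> \<mu> x)"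
      by (intro sum.cong refl) (simp add: c_def)
    also have "\<dots> = simplex_jacobi 3 (\<kappa> \<circ> transpose 1 2) \<nu> (simplex_ext 3 x \<circ> transpose 1 2)"
      unfolding R_def \<kappa>3' by (rule simplex_jacobi_3_transpose_12[symmetric]) (use \<kappa> \<nu> in auto)
    finally show ?thesis ..
  qed
  have c12: "conn_coeff 3 (transpose 1 2) \<kappa> \<nu> = c"
    by (rule conn_coeff_eqI[OF _ \<nu> _ c_expansion]) (use \<kappa>_gt in \<open>auto simp: c_def\<close>)
  have conn2: "conn_coeff2 (transpose 1 2) \<kappa>' (n - \<nu> 3) (\<nu> 2) (\<mu> 2) = R \<mu>" if "\<nu> 3 = \<mu> 3"
  proof -
    have "\<kappa>' i > -1" if "i \<in> {1..3}" for i
      using \<kappa>[of i] \<kappa>[of 3] \<kappa>[of 4] that by (simp add: \<kappa>' \<kappa>3')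
    moreover have "\<nu> 2 \<le> n - \<nu> 3" "\<mu> 2 \<le> n - \<nu> 3"
      using \<nu> \<mu> that by (auto simp: multi_indices_3_iff)
    ultimately show ?thesis by (subst conn_coeff2_transpose_12) (auto simp: R_def \<kappa>')
  qed
  show "conn_coeff 3 (transpose 1 2) \<kappa> \<nu> \<mu> =
      of_bool (\<nu> 3 = \<mu> 3) * conn_coeff2 (transpose 1 2) \<kappa>' (n - \<nu> 3) (\<nu> 2) (\<mu> 2)"
    unfolding c12 c_def using conn2 \<mu> by simp
  have "\<nu> 3 \<le> n" using \<nu> by (auto simp: multi_indices_3_iff)
  then have args: "- real (n - \<nu> 3) = - real n + real (\<nu> 3)"
    "real (n - \<nu> 3) + (\<kappa> 1 + \<kappa> 2 + \<kappa>3') + 2 = real n + real (\<nu> 3) + (\<Sum>i=1..4. \<kappa> i) + 3"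
    by (simp_all add: of_nat_diff \<kappa>3' numeral_eq_Suc)
  show "of_bool (\<nu> 3 = \<mu> 3) * conn_coeff2 (transpose 1 2) \<kappa>' (n - \<nu> 3) (\<nu> 2) (\<mu> 2) =
      of_bool (\<nu> 3 = \<mu> 3) * conn_const (\<kappa> 1) (\<kappa> 2) \<kappa>3' (n - \<nu> 3) (\<nu> 2) (\<mu> 2) *
      hypergeo_upto (min (\<mu> 2) (\<nu> 2))
        [- real (\<mu> 2), real (\<mu> 2) + \<kappa> 2 + \<kappa>3' + 1, - real (\<nu> 2), real (\<nu> 2) + \<kappa> 1 + \<kappa>3' + 1]
        [- real n + real (\<nu> 3), \<kappa>3' + 1, real n + real (\<nu> 3) + (\<Sum>i=1..4. \<kappa> i) + 3] 1"
    (is "?L = ?C * ?D * ?H")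
  proof (cases "\<nu> 3 = \<mu> 3")
    case True
    have "R \<mu> = ?D * ?H" unfolding R_def racah_coeff_def args ..
    then show ?thesis unfolding conn2[OF True] by (simp only: mult.assoc)
  next
    case False
    then show ?thesis by (simp only: of_bool_eq mult_zero_left)
  qed
  have ext: "simplex_jacobi 3 \<kappa> \<nu> (simplex_ext 3 x) = simplex_jacobi 3 \<kappa> \<nu> x" for x
    by (simp add: simplex_jacobi_3 simplex_ext_def)
  have "conn_coeff 3 (id \<circ> transpose 3 4) \<kappa> \<nu> = (\<lambda>\<mu>. if \<mu> = \<nu> then (-1) ^ \<nu> 3 else 0)"
  proof (rule conn_coeff_eqI[OF _ \<nu>])
    show "simplex_jacobi 3 (\<kappa> \<circ> (id \<circ> transpose 3 4)) \<nu> (simplex_ext 3 x \<circ> (id \<circ> transpose 3 4)) =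
        (\<Sum>\<mu>\<in>multi_indices 3 n. (if \<mu> = \<nu> then (-1) ^ \<nu> 3 else 0) * simplex_jacobi 3 \<kappa> \<mu> x)" for x
      using simplex_jacobi_3_comp_transpose_34[of id \<kappa> \<nu> x] \<nu>
      by (simp add: ext finite_multi_indices if_distrib[of "\<lambda>c. c * _"] cong: if_cong del: id_comp)
  qed (use \<kappa>_gt \<nu> in auto)
  then show "conn_coeff 3 (transpose 3 4) \<kappa> \<nu> \<mu> = (-1) ^ \<nu> 3 * of_bool (\<nu> = \<mu>)"
    by simp
  have "conn_coeff 3 (transpose 1 2 \<circ> transpose 3 4) \<kappa> \<nu> = (\<lambda>\<mu>. (-1) ^ \<nu> 3 * c \<mu>)"
  proof (rule conn_coeff_eqI[OF _ \<nu>])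
    show "simplex_jacobi 3 (\<kappa> \<circ> (transpose 1 2 \<circ> transpose 3 4)) \<nu>
          (simplex_ext 3 x \<circ> (transpose 1 2 \<circ> transpose 3 4)) =
        (\<Sum>\<mu>\<in>multi_indices 3 n. (-1) ^ \<nu> 3 * c \<mu> * simplex_jacobi 3 \<kappa> \<mu> x)" for x
    proof -
      have "simplex_jacobi 3 (\<kappa> \<circ> (transpose 1 2 \<circ> transpose 3 4)) \<nu>
            (simplex_ext 3 x \<circ> (transpose 1 2 \<circ> transpose 3 4)) =
          (-1) ^ \<nu> 3 * simplex_jacobi 3 (\<kappa> \<circ> transpose 1 2) \<nu> (simplex_ext 3 x \<circ> transpose 1 2)"
        by (rule simplex_jacobi_3_comp_transpose_34) (simp_all add: transpose_def)
      then show ?thesis unfolding c_expansion by (simp only: sum_distrib_left mult.assoc)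
    qed
  qed (use \<kappa>_gt in \<open>auto simp: c_def\<close>)
  then show "conn_coeff 3 (transpose 1 2 \<circ> transpose 3 4) \<kappa> \<nu> \<mu> =
      (-1) ^ \<nu> 3 * conn_coeff 3 (transpose 1 2) \<kappa> \<nu> \<mu>"
    by (simp only: c12)
qed

end
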